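(* Let $a',B,c,n$ be positive integers such that $a'>c$, $a'$ is not divisible by $3$, $a'$ and $c$ are relatively prime, and $B$ and $n$ are relatively prime. Define the formal power series $$\psi(q)=\sum_{j=0}^\infty\psi_jq^j:=\frac{(q^{Bc},q^{B(2a'-c)},q^{2Ba'};q^{2Ba'})_\infty\,(q^{2B(a'+c)},q^{2B(a'-c)};q^{4Ba'})_\infty}{(q^n;q^n)_\infty}.$$ If all prime divisors of $n$ different from $3$ divide $a'$, then $\psi_j\psi_{j+n}\ge0$ for all $j\in\mathbb Z_{\ge0}$.
   Context: Notation: $(u_1,\dots,u_k;v)_\infty:=\prod_{i=0}^\infty\prod_{j=1}^k(1-u_jv^i)$. *)

theory Defs
  imports "HOL-Analysis.Analysis" "HOL-Computational_Algebra.Computational_Algebra"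
begin

text \<open>
  The infinite product \<open>(u\<^sub>1, \<dots>, u\<^sub>k; v)\<^sub>\<infinity>\<close>, with the list \<open>us\<close> holding \<open>u\<^sub>1, \<dots>, u\<^sub>k\<close>. For formal power
  series the limit is taken in the \<open>X\<close>-adic metric on \<^typ>\<open>'a fps\<close>; it exists (and the library's
  \<^const>\<open>prodinf\<close> is then the limit of the partial products) whenever all of \<open>us\<close> and \<open>v\<close> have zero
  constant term.
\<close>

definition qpoch_inf :: "'a::{t2_space, comm_ring_1} list \<Rightarrow> 'a \<Rightarrow> 'a" where
  "qpoch_inf us v = (\<Prod>i. \<Prod>u\<leftarrow>us. 1 - u * v ^ i)"

text \<open>
  The subtractions of naturals below are exact for \<open>c \<le> a\<close>; the denominator is a unit for \<open>n > 0\<close>.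
\<close>

definition psi :: "nat \<Rightarrow> nat \<Rightarrow> nat \<Rightarrow> nat \<Rightarrow> real fps" where
  "psi a B c n =
     qpoch_inf [fps_X ^ (B * c), fps_X ^ (B * (2 * a - c)), fps_X ^ (2 * B * a)]
       (fps_X ^ (2 * B * a))
     * qpoch_inf [fps_X ^ (2 * B * (a + c)), fps_X ^ (2 * B * (a - c))] (fps_X ^ (4 * B * a))
     / qpoch_inf [fps_X ^ n] (fps_X ^ n)"

end

theory Submission
  imports Defs
begin

text \<open>
  Write \<open>(x)\<close> for the infinite product \<open>(x;x)\<close> and \<open>a\<close> for \<open>a'\<close>, and put \<open>Q = q^(2Ba)\<close>, \<open>z = q^(Bc)\<close>.

  The numerator of \<open>\<psi>\<close> is the product side of the quintuple product identity for \<open>z\<close> and \<open>Q\<close>, so it is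
  the difference of two theta series,
  \<open>\<Sum>k. q^(E1 k) - \<Sum>l. q^(E2 l)\<close> with \<open>E1 k = B k (3 a k - a + 3 c)\<close> and
  \<open>E2 l = B (3 l + 1) (a l + c)\<close> (lemma \<open>quintuple_product\<close>). The denominator is a series in \<open>q^n\<close>, so
  the coefficients of \<open>\<psi>\<close> with index in a fixed residue class modulo \<open>n\<close> see only those \<open>k\<close> and \<open>l\<close>
  whose exponents lie in that class. The differences
  \<open>E1 k - E1 k' = B (k - k') (3 a (k + k') - a + 3 c)\<close> and
  \<open>E2 l - E2 l' = B (l - l') (3 a (l + l') + a + 3 c)\<close> have, apart from the first bracket,
  only factors coprime to \<open>n\<close>: a prime divisor of \<open>n\<close> is \<open>3\<close>, which does not divide \<open>a\<close>, or it divides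
  \<open>a\<close> and then divides neither \<open>c\<close> nor \<open>3\<close>. Hence \<open>E1\<close> and \<open>E2\<close> permute the residues modulo \<open>n\<close>, and
  each class \<open>j\<close> of indices belongs to exactly one class \<open>k + n t\<close> and one class \<open>l + n t\<close>.

  Write \<open>n = u m\<close> with \<open>u\<close> a power of \<open>3\<close> and \<open>m\<close> prime to \<open>3\<close>. Since
  \<open>E2 l - E1 k = B w v\<close> with \<open>w = 3 (l - k) + 1\<close> and \<open>v = a (k + l) + c\<close>, and since \<open>v\<close> is coprime to \<open>m\<close>
  and \<open>w\<close> to \<open>3\<close>, we get \<open>w = m w'\<close> and \<open>v = u v'\<close>. Put \<open>p = 3 u B\<close>, \<open>p' = a m\<close>, \<open>r = B w'\<close>, \<open>s = v'\<close>.
  The part of \<open>\<psi>\<close> in the class of \<open>j\<close> then is, up to a power of \<open>q\<close> and with \<open>x = q^n\<close>, the series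
  \<open>(\<Sum>t. x^(t (p p' t + r p' - p s)) - \<Sum>t. x^((p t + r) (p' t + s))) / (x)\<close>,
  which for coprime \<open>p\<close> and \<open>p'\<close> is the Rocha-Caridi formula for a Virasoro character. It is enough that
  the coefficients of this series all have the same weak sign, because \<open>\<psi>\<^sub>j\<close> and \<open>\<psi>\<^sub>j\<^sub>+\<^sub>n\<close> are two of them.

  Translating and reflecting \<open>(r, s)\<close> changes the series only by a power of \<open>x\<close> and a sign, so one may
  assume \<open>0 \<le> r \<le> p\<close> and \<open>0 \<le> s \<le> p'\<close>; the roles of \<open>p\<close> and \<open>p'\<close> may be exchanged, and
  \<open>p \<noteq> p'\<close> because \<open>3\<close> divides only \<open>p\<close>. For \<open>p' < p\<close> the coefficients are nonnegative: they are limits of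
  the coefficients of polynomials in which \<open>1 / (x)\<close> is replaced by Gaussian binomials. These are the
  polynomials that count partitions with prescribed hook differences (Andrews, Baxter, Bressoud, Burge,
  Forrester and Viennot), and the two Pascal rules express each of them through smaller ones
  with nonnegative coefficients (lemma \<open>hook_diff_nonneg\<close>).

  The quintuple product identity is derived from Jacobi's triple product, applied to three different bases,
  and the triple product is a limit of a finite identity for Gaussian binomials.
\<close>

section \<open>Congruence of power series and infinite products\<close>

text \<open>
  Congruence modulo \<open>X^d\<close>. An \<open>X\<close>-adic limit is determined by its residues modulo all \<open>X^d\<close>, so
  identities between infinite products reduce to identities of finite ones.
\<close>
definition agree :: "nat \<Rightarrow> real fps \<Rightarrow> real fps \<Rightarrow> bool" where
  "agree d f g \<longleftrightarrow> (\<forall>i<d. fps_nth f i = fps_nth g i)"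

lemma agree_refl [simp]: "agree d f f" by (simp add: agree_def)
lemma agree_sym: "agree d f g \<Longrightarrow> agree d g f" by (simp add: agree_def)
lemma agree_trans [trans]: "agree d f g \<Longrightarrow> agree d g h \<Longrightarrow> agree d f h" by (simp add: agree_def)
lemma agree_mono: "agree d f g \<Longrightarrow> d' \<le> d \<Longrightarrow> agree d' f g" by (simp add: agree_def)

lemma agree_mult: "agree d f f' \<Longrightarrow> agree d g g' \<Longrightarrow> agree d (f * g) (f' * g')"
  by (auto simp: agree_def fps_mult_nth intro!: sum.cong)

lemma agree_prod: "(\<And>i. i \<in> I \<Longrightarrow> agree d (f i) (g i)) \<Longrightarrow> agree d (prod f I) (prod g I)"
  by (induction I rule: infinite_finite_induct) (auto intro: agree_mult)

lemma agree_all_imp_eq: "(\<And>d. agree d f g) \<Longrightarrow> f = g"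
  by (auto simp: agree_def fps_eq_iff)

lemma agree_one_minus: "d \<le> subdegree u \<Longrightarrow> agree d (1 - u) 1"
  unfolding agree_def
proof (intro allI impI)
  fix i assume "d \<le> subdegree u" "i < d"
  then have "fps_nth u i = 0" by (intro nth_less_subdegree_zero) linarith
  then show "fps_nth (1 - u) i = fps_nth 1 i" unfolding fps_sub_nth by linarith
qed

text \<open>
  Once the \<open>k\<close>-th factor is \<open>1\<close> modulo \<open>X^(k+1)\<close>, the coefficient of \<open>X^i\<close> in the partial products is
  constant from the product of \<open>i + 1\<close> factors on. The limit has constant coefficient \<open>1\<close>; being nonzero,
  it is the value of the infinite product in the sense of the library.
\<close>
lemma agree_prodinf:
  assumes F: "\<And>k. agree (Suc k) (F k) 1" and "d \<le> m"
  shows "agree d (prodinf F) (prod F {..<m})"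
proof -
  have stab: "agree d (prod F {..<m + k}) (prod F {..<m})" if "d \<le> m" for d m k
  proof (induction k)
    case (Suc k)
    have "agree d (prod F {..<m + k} * F (m + k)) (prod F {..<m} * 1)"
      by (intro agree_mult Suc agree_mono[OF F]) (use that in auto)
    then show ?case by simp
  qed simp
  define P where "P = Abs_fps (\<lambda>i. fps_nth (prod F {..<Suc i}) i)"
  have P: "agree d P (prod F {..<m})" if "d \<le> m" for d m
    unfolding agree_def
  proof (intro allI impI)
    fix i assume "i < d"
    with that have "agree (Suc i) (prod F {..<m}) (prod F {..<Suc i})"
      using stab[of "Suc i" "Suc i" "m - Suc i"] by simp
    then show "fps_nth P i = fps_nth (prod F {..<m}) i"
      by (simp add: P_def agree_def)
  qed
  have lim: "(\<lambda>m. \<Prod>i\<le>m. F (i + 0)) \<longlonglongrightarrow> P"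
  proof (rule tendsto_fpsI)
    fix i
    have "fps_nth (\<Prod>i\<le>m. F (i + 0)) i = fps_nth P i" if "m \<ge> i" for m
      using P[of "Suc i" "Suc m"] that by (simp add: agree_def lessThan_Suc_atMost del: prod.lessThan_Suc)
    then show "eventually (\<lambda>m. fps_nth (\<Prod>i\<le>m. F (i + 0)) i = fps_nth P i) at_top"
      using eventually_at_top_linorder by blast
  qed
  have "fps_nth P 0 = fps_nth (F 0) 0" by (simp add: P_def)
  also have "\<dots> = 1" using F[of 0] by (simp add: agree_def)
  finally have "P \<noteq> 0" by auto
  with lim have "F has_prod P" by (auto simp: has_prod_def raw_has_prod_def)
  then have "prodinf F = P" using has_prod_unique by blast
  with P[OF \<open>d \<le> m\<close>] show ?thesis by simp
qed

lemma agree_prod_list_one: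
  assumes "\<And>u. u \<in> set us \<Longrightarrow> agree d (f u) 1"
  shows "agree d (\<Prod>u\<leftarrow>us. f u) 1"
  using assms
proof (induction us)
  case (Cons u us)
  have "agree d (f u * (\<Prod>u\<leftarrow>us. f u)) (1 * 1)"
    by (intro agree_mult Cons.IH) (use Cons.prems in auto)
  then show ?case by simp
qed simp

lemma agree_one_minus_mult_power:
  fixes u v :: "real fps"
  assumes "fps_nth u 0 = 0" "fps_nth v 0 = 0"
  shows "agree (Suc k) (1 - u * v ^ k) 1"
proof (cases "u * v ^ k = 0")
  case False
  then have "u \<noteq> 0" "v ^ k \<noteq> 0" by auto
  have "subdegree u > 0" using \<open>u \<noteq> 0\<close> assms by (simp add: subdegree_eq_0_iff flip: neq0_conv)
  moreover have "k \<le> subdegree (v ^ k)"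
  proof (cases "k = 0")
    case False
    with \<open>v ^ k \<noteq> 0\<close> have "v \<noteq> 0" by auto
    with assms have "subdegree v > 0" by (simp add: subdegree_eq_0_iff flip: neq0_conv)
    then show ?thesis by simp
  qed simp
  moreover have "subdegree (u * v ^ k) = subdegree u + subdegree (v ^ k)"
    using \<open>u \<noteq> 0\<close> \<open>v ^ k \<noteq> 0\<close> by (rule subdegree_mult)
  ultimately have "Suc k \<le> subdegree (u * v ^ k)" by linarith
  then show ?thesis by (rule agree_one_minus)
qed (simp only: diff_zero agree_refl)

lemma agree_qpoch_inf:
  assumes "\<And>u. u \<in> set us \<Longrightarrow> fps_nth u 0 = 0" "fps_nth v 0 = 0" "d \<le> m"
  shows "agree d (qpoch_inf us v) (\<Prod>i<m. \<Prod>u\<leftarrow>us. 1 - u * v ^ i)"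
  unfolding qpoch_inf_def
  by (intro agree_prodinf agree_prod_list_one agree_one_minus_mult_power assms)

lemma qpoch_inf_append:
  assumes "\<And>u. u \<in> set us \<union> set vs \<Longrightarrow> fps_nth u 0 = 0" "fps_nth v 0 = 0"
  shows "qpoch_inf (us @ vs) v = (qpoch_inf us v * qpoch_inf vs v :: real fps)"
proof (rule agree_all_imp_eq)
  fix d
  have "agree d (qpoch_inf us v * qpoch_inf vs v)
     ((\<Prod>i<d. \<Prod>u\<leftarrow>us. 1 - u * v ^ i) * (\<Prod>i<d. \<Prod>u\<leftarrow>vs. 1 - u * v ^ i))"
    by (intro agree_mult agree_qpoch_inf) (use assms in auto)
  then have "agree d (qpoch_inf us v * qpoch_inf vs v) (\<Prod>i<d. \<Prod>u\<leftarrow>us @ vs. 1 - u * v ^ i)"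
    by (simp add: prod.distrib)
  moreover have "agree d (qpoch_inf (us @ vs) v) (\<Prod>i<d. \<Prod>u\<leftarrow>us @ vs. 1 - u * v ^ i)"
    by (intro agree_qpoch_inf) (use assms in auto)
  ultimately show "agree d (qpoch_inf (us @ vs) v) (qpoch_inf us v * qpoch_inf vs v)"
    by (meson agree_sym agree_trans)
qed

lemma qpoch_inf_nth_0:
  assumes "\<And>u. u \<in> set us \<Longrightarrow> fps_nth u 0 = 0" "fps_nth v 0 = 0"
  shows "fps_nth (qpoch_inf us v :: real fps) 0 = 1"
proof -
  have "agree (Suc 0) (\<Prod>u\<leftarrow>us. 1 - u * v ^ 0) 1"
    by (intro agree_prod_list_one agree_one_minus_mult_power assms)
  with agree_qpoch_inf[OF assms, where d = 1 and m = 1] show ?thesis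
    by (simp add: agree_def)
qed

section \<open>Gaussian binomials\<close>

text \<open>
  The Gaussian binomial with base \<open>Q\<close>. The lower index is an integer, and the value is \<open>0\<close>
  outside \<open>0 \<le> k \<le> A\<close>, so that bilateral sums need no boundary terms. For negative \<open>k\<close> the power
  \<open>Q ^ nat k\<close> is harmless since it multiplies \<open>0\<close>.
\<close>
fun gauss :: "'a::comm_ring_1 \<Rightarrow> nat \<Rightarrow> int \<Rightarrow> 'a" where
  "gauss Q 0 k = (if k = 0 then 1 else 0)"
| "gauss Q (Suc A) k = gauss Q A (k - 1) + Q ^ nat k * gauss Q A k"

lemma gauss_eq_0: "k < 0 \<or> k > int A \<Longrightarrow> gauss Q A k = 0"
  by (induction A arbitrary: k) auto

lemma gauss_0_right [simp]: "gauss Q A 0 = 1"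
  by (induction A) (auto simp: gauss_eq_0)

text \<open>
  The mirror image of the defining recurrence; the positivity proof below uses one or the other
  according to which of them stays inside the region where positivity holds.
\<close>
lemma gauss_Suc': "gauss Q (Suc A) k = gauss Q A k + Q ^ nat (int A + 1 - k) * gauss Q A (k - 1)"
proof (induction A arbitrary: k)
  case 0
  then show ?case by auto
next
  case (Suc A)
  show ?case
  proof (cases "0 \<le> k \<and> k \<le> int A + 2")
    case False
    then show ?thesis by (auto simp: gauss_eq_0 simp del: gauss.simps)
  next
    case True
    show ?thesis
    proof (cases "k = 0")
      case True
      then show ?thesis by (simp add: gauss_eq_0 del: gauss.simps)
    next
      case nz: False
      have *: "Q ^ nat k * Q ^ nat (int A + 1 - k) * gauss Q A (k - 1)
          = Q ^ nat (int A + 2 - k) * Q ^ nat (k - 1) * gauss Q A (k - 1)"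
      proof (cases "k - 1 \<le> int A")
        case True
        then show ?thesis using nz \<open>0 \<le> k \<and> k \<le> int A + 2\<close>
          by (cases "k = 0") (auto simp: power_add[symmetric] simp flip: nat_add_distrib)
      qed (simp add: gauss_eq_0)
      have "gauss Q (Suc (Suc A)) k = gauss Q (Suc A) (k - 1) + Q ^ nat k * gauss Q (Suc A) k"
        by simp
      also have "\<dots> = gauss Q A (k - 1) + Q ^ nat (int A + 2 - k) * gauss Q A (k - 2)
          + Q ^ nat k * gauss Q A k + Q ^ nat k * Q ^ nat (int A + 1 - k) * gauss Q A (k - 1)"
        unfolding Suc.IH by (simp add: algebra_simps)
      also have "\<dots> = gauss Q (Suc A) k + Q ^ nat (int (Suc A) + 1 - k) * gauss Q (Suc A) (k - 1)"
        unfolding * by (simp add: algebra_simps)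
      finally show ?thesis .
    qed
  qed
qed

lemma gauss_symm: "gauss Q A (int A - k) = gauss Q A k"
proof (induction A arbitrary: k)
  case (Suc A)
  have "gauss Q (Suc A) (int (Suc A) - k) = gauss Q A (int A - k) + Q ^ nat (int A + 1 - k) * gauss Q A (int A - (k - 1))"
    by (simp add: algebra_simps)
  also have "\<dots> = gauss Q A k + Q ^ nat (int A + 1 - k) * gauss Q A (k - 1)"
    by (simp only: Suc.IH)
  also have "\<dots> = gauss Q (Suc A) k" by (simp only: gauss_Suc')
  finally show ?case .
qed auto

lemma gauss_mult_prod:
  "gauss Q (m + k) (int k) * (\<Prod>i<k. 1 - Q ^ Suc i) = (\<Prod>i<k. 1 - Q ^ Suc (m + i))"
proof (induction k arbitrary: m)
  case (Suc k)
  show ?case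
  proof (induction m)
    case 0
    have "gauss Q n (int n) = 1" for n using gauss_symm[of Q n 0] by simp
    from this[of "Suc k"] show ?case by (simp del: gauss.simps of_nat_Suc)
  next
    case (Suc m)
    have "gauss Q (Suc m + Suc k) (int (Suc k))
       = gauss Q (Suc m + k) (int k) + Q ^ Suc k * gauss Q (m + Suc k) (int (Suc k))"
      by (simp add: nat_add_distrib)
    then have "gauss Q (Suc m + Suc k) (int (Suc k)) * (\<Prod>i<Suc k. 1 - Q ^ Suc i)
       = gauss Q (Suc m + k) (int k) * (\<Prod>i<k. 1 - Q ^ Suc i) * (1 - Q ^ Suc k)
       + Q ^ Suc k * (gauss Q (m + Suc k) (int (Suc k)) * (\<Prod>i<Suc k. 1 - Q ^ Suc i))"
      by (simp add: algebra_simps del: gauss.simps)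
    also have "\<dots> = (\<Prod>i<k. 1 - Q ^ Suc (Suc m + i)) * (1 - Q ^ Suc k) + Q ^ Suc k * (\<Prod>i<Suc k. 1 - Q ^ Suc (m + i))"
      unfolding Suc.IH Suc.prems using \<open>\<And>m. gauss Q (m + k) (int k) * (\<Prod>i<k. 1 - Q ^ Suc i) = (\<Prod>i<k. 1 - Q ^ Suc (m + i))\<close>[of "Suc m"] by simp
    also have "(\<Prod>i<Suc k. 1 - Q ^ Suc (m + i)) = (1 - Q ^ Suc m) * (\<Prod>i<k. 1 - Q ^ Suc (Suc m + i))"
      by (subst prod.lessThan_Suc_shift) simp
    also have "(\<Prod>i<k. 1 - Q ^ Suc (Suc m + i)) * (1 - Q ^ Suc k) + Q ^ Suc k * ((1 - Q ^ Suc m) * (\<Prod>i<k. 1 - Q ^ Suc (Suc m + i)))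
       = (\<Prod>i<k. 1 - Q ^ Suc (Suc m + i)) * (1 - Q ^ Suc (Suc m + k))"
      by (simp add: algebra_simps power_add)
    also have "\<dots> = (\<Prod>i<Suc k. 1 - Q ^ Suc (Suc m + i))" by simp
    finally show ?case .
  qed
qed simp

text \<open>
  Far from both ends of its row the Gaussian binomial agrees to high order with the
  reciprocal of the full product \<open>(1 - Q) (1 - Q^2) \<dots>\<close>: in the product formula the right hand side has only
  factors close to \<open>1\<close>.
\<close>
lemma agree_gauss_mult_prod:
  fixes Q :: "real fps"
  assumes "fps_nth Q 0 = 0" "int d \<le> k" "int d \<le> int A - k" "d \<le> m"
  shows "agree d (gauss Q A k * (\<Prod>i<m. 1 - Q ^ Suc i)) 1"
proof -
  have fac: "agree d (1 - Q ^ Suc i) 1" if "d \<le> Suc i" for i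
    using agree_one_minus_mult_power[of Q Q i] assms(1) that agree_mono by force
  have "agree d (\<Prod>i<m'. 1 - Q ^ Suc i) (\<Prod>i<d. 1 - Q ^ Suc i)" if "d \<le> m'" for m'
  proof -
    have "(\<Prod>i<m'. 1 - Q ^ Suc i) = (\<Prod>i<d. 1 - Q ^ Suc i) * (\<Prod>i\<in>{d..<m'}. 1 - Q ^ Suc i)"
      using that by (subst prod.union_disjoint[symmetric]) (auto intro!: prod.cong)
    moreover have "agree d (\<Prod>i\<in>{d..<m'}. 1 - Q ^ Suc i) (\<Prod>i\<in>{d..<m'}. 1)"
      by (intro agree_prod fac) auto
    ultimately show ?thesis
      using agree_mult[OF agree_refl[of d "\<Prod>i<d. 1 - Q ^ Suc i"], of "\<Prod>i\<in>{d..<m'}. 1 - Q ^ Suc i" 1] by simp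
  qed
  moreover have "d \<le> nat k" using assms by linarith
  ultimately have 1: "agree d (\<Prod>i<m. 1 - Q ^ Suc i) (\<Prod>i<nat k. 1 - Q ^ Suc i)"
    using \<open>d \<le> m\<close> by (meson agree_sym agree_trans)
  define m' where "m' = nat (int A - k)"
  have A: "A = m' + nat k" "k = int (nat k)" using assms by (auto simp: m'_def)
  have "agree d (gauss Q A k * (\<Prod>i<m. 1 - Q ^ Suc i)) (gauss Q A k * (\<Prod>i<nat k. 1 - Q ^ Suc i))"
    by (intro agree_mult 1) simp
  also have "gauss Q A k * (\<Prod>i<nat k. 1 - Q ^ Suc i) = (\<Prod>i<nat k. 1 - Q ^ Suc (m' + i))"
    using gauss_mult_prod[of Q m' "nat k"] A by metis
  also have "agree d (\<Prod>i<nat k. 1 - Q ^ Suc (m' + i)) (\<Prod>i<nat k. 1)"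
    by (intro agree_prod fac) (use assms in \<open>auto simp: m'_def\<close>)
  finally show ?thesis by simp
qed

section \<open>Series given by their exponents\<close>

text \<open>
  The series \<open>\<Sum>i\<in>I. w i q^(E i)\<close>. Exponents are integers, so that quadratic forms on \<open>\<int>\<close>
  can be substituted without coercions; a term with a negative exponent would be dropped, and
  an exponent attained infinitely often would count as \<open>0\<close>. Unions therefore assume
  finite fibres, and products also nonnegative exponents.
\<close>
definition qseries :: "'i set \<Rightarrow> ('i \<Rightarrow> real) \<Rightarrow> ('i \<Rightarrow> int) \<Rightarrow> real fps" where
  "qseries I w E = Abs_fps (\<lambda>n. \<Sum>i\<in>{i\<in>I. E i = int n}. w i)"

lemma qseries_nth: "fps_nth (qseries I w E) n = (\<Sum>i\<in>{i\<in>I. E i = int n}. w i)"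
  by (simp add: qseries_def)

lemma qseries_reindex:
  assumes "bij_betw h J I" "\<And>j. j \<in> J \<Longrightarrow> w' j = w (h j)" "\<And>j. j \<in> J \<Longrightarrow> E' j = E (h j)"
  shows "qseries I w E = qseries J w' E'"
proof (rule fps_ext)
  fix n
  have "bij_betw h {j\<in>J. E' j = int n} {i\<in>I. E i = int n}"
    using assms(1,3) by (auto simp: bij_betw_def inj_on_def image_iff)
  then have "(\<Sum>i\<in>{i\<in>I. E i = int n}. w i) = (\<Sum>j\<in>{j\<in>J. E' j = int n}. w (h j))"
    by (rule sum.reindex_bij_betw[symmetric])
  also have "\<dots> = (\<Sum>j\<in>{j\<in>J. E' j = int n}. w' j)"
    by (intro sum.cong) (auto simp: assms)
  finally show "fps_nth (qseries I w E) n = fps_nth (qseries J w' E') n" by (simp add: qseries_nth)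
qed

lemma qseries_Un:
  assumes "I \<inter> J = {}" "\<And>n. finite {i\<in>I \<union> J. E i = int n}"
  shows "qseries (I \<union> J) w E = qseries I w E + qseries J w E"
proof (rule fps_ext)
  fix n
  have "{i\<in>I \<union> J. E i = int n} = {i\<in>I. E i = int n} \<union> {i\<in>J. E i = int n}" by auto
  moreover from this assms(2)[of n] have "finite {i\<in>I. E i = int n}" "finite {i\<in>J. E i = int n}"
    by auto
  ultimately show "fps_nth (qseries (I \<union> J) w E) n = fps_nth (qseries I w E + qseries J w E) n"
    unfolding qseries_nth fps_add_nth using assms(1) by (simp add: sum.union_disjoint disjoint_iff)
qed

lemma qseries_uminus: "qseries I (\<lambda>i. - w i) E = - qseries I w E"
  by (rule fps_ext) (simp add: qseries_nth sum_negf)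

lemma qseries_mult:
  assumes "\<And>i. i \<in> I \<Longrightarrow> E i \<ge> 0" "\<And>j. j \<in> J \<Longrightarrow> F j \<ge> 0"
    and "\<And>n. finite {i\<in>I. E i = int n}" "\<And>n. finite {j\<in>J. F j = int n}"
  shows "qseries I w E * qseries J v F = qseries (I \<times> J) (\<lambda>(i,j). w i * v j) (\<lambda>(i,j). E i + F j)"
proof (rule fps_ext)
  fix n
  have eq: "{p\<in>I \<times> J. (case p of (i,j) \<Rightarrow> E i + F j) = int n}
      = (\<Union>m\<in>{0..n}. {i\<in>I. E i = int m} \<times> {j\<in>J. F j = int (n - m)})"
  proof (intro equalityI subsetI)
    fix p assume "p \<in> {p\<in>I \<times> J. (case p of (i,j) \<Rightarrow> E i + F j) = int n}"
    then obtain i j where p: "p = (i, j)" "i \<in> I" "j \<in> J" "E i + F j = int n" by auto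
    with assms(1)[of i] assms(2)[of j] have "nat (E i) \<in> {0..n}" "E i = int (nat (E i))" "F j = int (n - nat (E i))"
      by auto
    with p show "p \<in> (\<Union>m\<in>{0..n}. {i\<in>I. E i = int m} \<times> {j\<in>J. F j = int (n - m)})"
      by blast
  qed auto
  have "fps_nth (qseries I w E * qseries J v F) n
     = (\<Sum>m=0..n. (\<Sum>i\<in>{i\<in>I. E i = int m}. w i) * (\<Sum>j\<in>{j\<in>J. F j = int (n - m)}. v j))"
    by (simp add: fps_mult_nth qseries_nth)
  also have "\<dots> = (\<Sum>m=0..n. \<Sum>(i,j)\<in>{i\<in>I. E i = int m} \<times> {j\<in>J. F j = int (n - m)}. w i * v j)"
    by (simp add: sum_product sum.cartesian_product)
  also have "\<dots> = (\<Sum>(i,j)\<in>(\<Union>m\<in>{0..n}. {i\<in>I. E i = int m} \<times> {j\<in>J. F j = int (n - m)}). w i * v j)"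
    by (rule sum.UNION_disjoint[symmetric]) (use assms(3,4) in \<open>auto simp del: of_nat_diff\<close>)
  finally show "fps_nth (qseries I w E * qseries J v F) n
     = fps_nth (qseries (I \<times> J) (\<lambda>(i,j). w i * v j) (\<lambda>(i,j). E i + F j)) n"
    unfolding qseries_nth eq .
qed

lemma qseries_mult_finite:
  assumes "\<And>i. i \<in> I \<Longrightarrow> E i \<ge> 0" "\<And>j. j \<in> J \<Longrightarrow> F j \<ge> 0"
    and "\<And>n. finite {i\<in>I. E i = int n}" "\<And>n. finite {j\<in>J. F j = int n}"
  shows "finite {p\<in>I \<times> J. (case p of (i,j) \<Rightarrow> E i + F j) = int n}"
proof (rule finite_subset)
  show "{p\<in>I \<times> J. (case p of (i,j) \<Rightarrow> E i + F j) = int n} \<subseteq> 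
     (\<Union>m\<in>{0..n}. {i\<in>I. E i = int m}) \<times> (\<Union>m\<in>{0..n}. {j\<in>J. F j = int m})"
  proof
    fix p assume "p \<in> {p\<in>I \<times> J. (case p of (i,j) \<Rightarrow> E i + F j) = int n}"
    then obtain i j where p: "p = (i, j)" "i \<in> I" "j \<in> J" "E i + F j = int n" by auto
    with assms(1)[of i] assms(2)[of j] have "nat (E i) \<in> {0..n}" "E i = int (nat (E i))"
      "nat (F j) \<in> {0..n}" "F j = int (nat (F j))"
      by auto
    with p show "p \<in> (\<Union>m\<in>{0..n}. {i\<in>I. E i = int m}) \<times> (\<Union>m\<in>{0..n}. {j\<in>J. F j = int m})"
      by blast
  qed
qed (use assms(3,4) in auto)

section \<open>Jacobi's triple product\<close>

definition sgnpow :: "int \<Rightarrow> real" where "sgnpow k = (if even k then 1 else -1)"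

text \<open>
  With \<open>z = q^s\<close> and \<open>Q = q^(s+t)\<close> this is the exponent of \<open>Q^(k(k-1)/2) z^k\<close>.
\<close>
definition theta_exponent :: "nat \<Rightarrow> nat \<Rightarrow> int \<Rightarrow> int" where
  "theta_exponent s t k = (int s + int t) * ((k * (k - 1)) div 2) + int s * k"

lemma two_theta_exponent: "2 * theta_exponent s t k = (int s + int t) * (k * (k - 1)) + 2 * int s * k"
proof -
  have "even (k * (k - 1))" by auto
  then have "2 * ((k * (k - 1)) div 2) = k * (k - 1)" by auto
  then show ?thesis unfolding theta_exponent_def by (metis distrib_left mult.left_commute mult.assoc)
qed

lemma theta_exponent_Suc: "theta_exponent s t (k + 1) = theta_exponent s t k + (int s + int t) * k + int s"
proof -
  have "2 * theta_exponent s t (k + 1) = 2 * (theta_exponent s t k + (int s + int t) * k + int s)"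
    unfolding two_theta_exponent distrib_left by (simp add: algebra_simps)
  then show ?thesis by simp
qed

lemma theta_exponent_ge:
  assumes "s > 0" "t > 0"
  shows "theta_exponent s t k \<ge> \<bar>k\<bar>"
proof (cases "k \<ge> 0")
  case True
  then have "k * (k - 1) \<ge> 0" by (cases "k = 0") auto
  then have "(int s + int t) * (k * (k - 1)) \<ge> 0" by simp
  moreover have "int s * k \<ge> 1 * k" using assms True by (intro mult_right_mono) auto
  ultimately show ?thesis using two_theta_exponent[of s t k] True by linarith
next
  case False
  define j where "j = - k"
  have j: "j \<ge> 1" using False by (simp add: j_def)
  have "2 * theta_exponent s t k = int s * (j * (j - 1)) + int t * (j * (j + 1))"
    unfolding two_theta_exponent j_def by (simp add: algebra_simps)
  moreover have "int s * (j * (j - 1)) \<ge> 0" using j by simp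
  moreover have "j * (j + 1) \<le> int t * (j * (j + 1))"
    using mult_right_mono[of 1 "int t" "j * (j + 1)"] assms j by simp
  moreover have "2 * j \<le> j * (j + 1)" using mult_left_mono[of 2 "j + 1" j] j by (simp add: mult.commute)
  ultimately have "2 * theta_exponent s t k \<ge> 2 * j" by linarith
  then show ?thesis using False by (simp add: j_def)
qed

text \<open>
  Raising \<open>m\<close> by one multiplies the product by \<open>1 - z Q^m\<close>. On the sum side the extra term with index
  \<open>k\<close> has the same power of \<open>q\<close> as the second Pascal term with index \<open>k + 1\<close>, and the alternating sign matches
  the minus sign. Raising \<open>n\<close> works in the same way with the other Pascal rule.
\<close>
lemma finite_jacobi_triple_product:
  assumes "s > 0" "t > 0"
  defines "Q \<equiv> fps_X ^ (s + t) :: real fps"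
  shows "(\<Prod>i<m. 1 - fps_X ^ s * Q ^ i) * (\<Prod>i<n. 1 - fps_X ^ t * Q ^ i)
     = (\<Sum>k\<in>{-int n..int m}. fps_const (sgnpow k) * fps_X ^ nat (theta_exponent s t k) * gauss Q (m + n) (int n + k))"
    (is "?L m n = ?R m n")
proof -
  have e0: "theta_exponent s t k \<ge> 0" for k using theta_exponent_ge[OF assms(1,2), of k] by linarith
  have Qp: "Q ^ i = fps_X ^ ((s + t) * i)" for i by (simp add: Q_def power_mult)
  let ?c = "\<lambda>k. fps_const (sgnpow k) * fps_X ^ nat (theta_exponent s t k) :: real fps"
  \<comment> \<open>The range of summation may be enlarged at will, since the Gaussian binomial vanishes outside.\<close>
  have R: "?R m n = (\<Sum>k\<in>{-int N..int N}. ?c k * gauss Q (m + n) (int n + k))" if "N \<ge> m" "N \<ge> n" for m n N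
    by (intro sum.mono_neutral_left) (use that in \<open>auto intro!: gauss_eq_0\<close>)
  \<comment> \<open>The guard on \<open>g\<close> covers the indices for which \<open>nat (int m - k)\<close> truncates; the Gaussian binomial is \<open>0\<close> there.\<close>
  have c: "?c k * fps_X ^ s * Q ^ m * g (k + 1) = - (?c (k + 1) * Q ^ nat (int m - k) * g (k + 1))"
    if "\<And>k. k > int m + 1 \<Longrightarrow> g k = 0" for k m and g :: "int \<Rightarrow> real fps"
  proof (cases "k \<le> int m")
    case True
    have "nat (theta_exponent s t k) + s + (s + t) * m = nat (theta_exponent s t (k + 1)) + (s + t) * nat (int m - k)"
      using e0[of k] e0[of "k + 1"] True unfolding theta_exponent_Suc
      by (intro iffD1[OF of_nat_eq_iff[where 'a = int]]) (simp add: algebra_simps)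
    then have "(fps_X :: real fps) ^ nat (theta_exponent s t k) * fps_X ^ s * Q ^ m
       = fps_X ^ nat (theta_exponent s t (k + 1)) * Q ^ nat (int m - k)"
      unfolding Qp power_add[symmetric] by simp
    then have "?c k * fps_X ^ s * Q ^ m = - (?c (k + 1) * Q ^ nat (int m - k))"
      by (simp add: sgnpow_def mult.assoc flip: fps_const_neg)
    then show ?thesis by simp
  qed (simp add: that)
  have c': "?c k * fps_X ^ t * Q ^ n * g (k - 1) = - (?c (k - 1) * Q ^ nat (int n + k) * g (k - 1))"
    if "\<And>k. k < - int n - 1 \<Longrightarrow> g k = 0" for k n and g :: "int \<Rightarrow> real fps"
  proof (cases "k \<ge> - int n")
    case True
    have "nat (theta_exponent s t k) + t + (s + t) * n = nat (theta_exponent s t (k - 1)) + (s + t) * nat (int n + k)"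
      using e0[of k] e0[of "k - 1"] True theta_exponent_Suc[of s t "k - 1"]
      by (intro iffD1[OF of_nat_eq_iff[where 'a = int]]) (simp add: algebra_simps)
    then have "(fps_X :: real fps) ^ nat (theta_exponent s t k) * fps_X ^ t * Q ^ n
       = fps_X ^ nat (theta_exponent s t (k - 1)) * Q ^ nat (int n + k)"
      unfolding Qp power_add[symmetric] by simp
    then have "?c k * fps_X ^ t * Q ^ n = - (?c (k - 1) * Q ^ nat (int n + k))"
      by (simp add: sgnpow_def mult.assoc flip: fps_const_neg)
    then show ?thesis by simp
  qed (simp add: that)
  have "?L m n = ?R m n"
  proof (induction n)
    case 0
    show ?case
    proof (induction m)
      case 0
      show ?case by (simp add: theta_exponent_def sgnpow_def)
    next
      case (Suc m)
      let ?N = "Suc m"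
      have "?R (Suc m) 0 = (\<Sum>k\<in>{-int ?N..int ?N}. ?c k * gauss Q (Suc m) k)"
        using R[of "Suc m" ?N 0] by simp
      also have "\<dots> = (\<Sum>k\<in>{-int ?N..int ?N}. ?c k * gauss Q m k) 
          + (\<Sum>k\<in>{-int ?N..int ?N}. ?c k * Q ^ nat (int m + 1 - k) * gauss Q m (k - 1))"
        unfolding gauss_Suc' by (simp add: algebra_simps sum.distrib)
      also have "(\<Sum>k\<in>{-int ?N..int ?N}. ?c k * Q ^ nat (int m + 1 - k) * gauss Q m (k - 1))
          = (\<Sum>k\<in>{-int ?N-1..int m}. ?c (k + 1) * Q ^ nat (int m - k) * gauss Q m k)"
        by (rule sum.reindex_bij_witness[of _ "\<lambda>k. k + 1" "\<lambda>k. k - 1"]) (auto simp: algebra_simps)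
      also have "\<dots> = (\<Sum>k\<in>{-int ?N..int ?N}. ?c (k + 1) * Q ^ nat (int m - k) * gauss Q m k)"
        by (intro sum.mono_neutral_cong) (auto simp: gauss_eq_0)
      also have "\<dots> = (\<Sum>k\<in>{-int ?N..int ?N}. - (?c k * fps_X ^ s * Q ^ m * gauss Q m k))"
        by (intro sum.cong refl) (use c[of m "\<lambda>k. gauss Q m (k - 1)"] in \<open>simp add: gauss_eq_0\<close>)
      also have "(\<Sum>k\<in>{-int ?N..int ?N}. ?c k * gauss Q m k) + \<dots> 
         = (\<Sum>k\<in>{-int ?N..int ?N}. ?c k * gauss Q m k) * (1 - fps_X ^ s * Q ^ m)"
        by (simp add: algebra_simps sum_distrib_right sum_negf sum_distrib_left sum_subtractf)
      also have "(\<Sum>k\<in>{-int ?N..int ?N}. ?c k * gauss Q m k) = ?L m 0"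
        using R[of m ?N 0] Suc by simp
      finally show ?case by simp
    qed
  next
    case (Suc n)
    let ?N = "m + Suc n"
    have "?R m (Suc n) = (\<Sum>k\<in>{-int ?N..int ?N}. ?c k * gauss Q (Suc (m + n)) (int n + k + 1))"
      using R[of m ?N "Suc n"] by (simp add: algebra_simps del: gauss.simps)
    also have "\<dots> = (\<Sum>k\<in>{-int ?N..int ?N}. ?c k * gauss Q (m + n) (int n + k)) 
        + (\<Sum>k\<in>{-int ?N..int ?N}. ?c k * Q ^ nat (int n + k + 1) * gauss Q (m + n) (int n + k + 1))"
      unfolding gauss.simps by (simp add: algebra_simps sum.distrib)
    also have "(\<Sum>k\<in>{-int ?N..int ?N}. ?c k * Q ^ nat (int n + k + 1) * gauss Q (m + n) (int n + k + 1))
        = (\<Sum>k\<in>{-int ?N+1..int ?N+1}. ?c (k - 1) * Q ^ nat (int n + k) * gauss Q (m + n) (int n + k))"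
      by (rule sum.reindex_bij_witness[of _ "\<lambda>k. k - 1" "\<lambda>k. k + 1"]) (auto simp: algebra_simps)
    also have "\<dots> = (\<Sum>k\<in>{-int ?N..int ?N}. ?c (k - 1) * Q ^ nat (int n + k) * gauss Q (m + n) (int n + k))"
      by (intro sum.mono_neutral_cong) (auto simp: gauss_eq_0)
    also have "\<dots> = (\<Sum>k\<in>{-int ?N..int ?N}. - (?c k * fps_X ^ t * Q ^ n * gauss Q (m + n) (int n + k)))"
      by (intro sum.cong refl) (use c'[of n "\<lambda>k. gauss Q (m + n) (int n + k + 1)"] in \<open>simp add: gauss_eq_0\<close>)
    also have "(\<Sum>k\<in>{-int ?N..int ?N}. ?c k * gauss Q (m + n) (int n + k)) + \<dots> 
       = (\<Sum>k\<in>{-int ?N..int ?N}. ?c k * gauss Q (m + n) (int n + k)) * (1 - fps_X ^ t * Q ^ n)"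
      by (simp add: algebra_simps sum_distrib_right sum_negf sum_distrib_left sum_subtractf)
    also have "(\<Sum>k\<in>{-int ?N..int ?N}. ?c k * gauss Q (m + n) (int n + k)) = ?L m n"
      using R[of m ?N n] Suc by simp
    finally show ?case by (simp add: mult.assoc)
  qed
  then show ?thesis .
qed

text \<open>
  After multiplication by \<open>(Q;Q)\<close> every Gaussian binomial in the finite identity tends to \<open>1\<close>, and modulo
  \<open>X^d\<close> only the indices \<open>\<bar>k\<bar> \<le> d\<close> contribute, because the exponent is at least \<open>\<bar>k\<bar>\<close>.
\<close>
theorem jacobi_triple_product:
  assumes "s > 0" "t > 0"
  shows "qpoch_inf [fps_X ^ s, fps_X ^ t, fps_X ^ (s + t)] (fps_X ^ (s + t)) = qseries UNIV sgnpow (theta_exponent s t)"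
proof (rule agree_all_imp_eq)
  fix d :: nat
  define Q where "Q = (fps_X ^ (s + t) :: real fps)"
  have Q0: "fps_nth Q 0 = 0" using assms by (simp add: Q_def)
  \<comment> \<open>For \<open>\<bar>k\<bar> \<le> d\<close> the entry \<open>n + k\<close> of row \<open>2 n\<close> is at distance at least \<open>d\<close> from both ends.\<close>
  define n where "n = 2 * d"
  let ?c = "\<lambda>k. fps_const (sgnpow k) * fps_X ^ nat (theta_exponent s t k) :: real fps"
  have e0: "theta_exponent s t k \<ge> 0" for k using theta_exponent_ge[OF assms(1,2), of k] by linarith
  have "agree d (qpoch_inf [fps_X ^ s, fps_X ^ t, Q] Q) (\<Prod>i<n. \<Prod>u\<leftarrow>[fps_X ^ s, fps_X ^ t, Q]. 1 - u * Q ^ i)"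
    by (rule agree_qpoch_inf) (use assms Q0 in \<open>auto simp: n_def\<close>)
  also have "(\<Prod>i<n. \<Prod>u\<leftarrow>[fps_X ^ s, fps_X ^ t, Q]. 1 - u * Q ^ i)
     = (\<Prod>i<n. 1 - fps_X ^ s * Q ^ i) * (\<Prod>i<n. 1 - fps_X ^ t * Q ^ i) * (\<Prod>i<n. 1 - Q ^ Suc i)"
    by (simp add: prod.distrib mult.assoc)
  also have "\<dots> = (\<Sum>k\<in>{-int n..int n}. ?c k * (gauss Q (n + n) (int n + k) * (\<Prod>i<n. 1 - Q ^ Suc i)))"
    unfolding Q_def finite_jacobi_triple_product[OF assms] sum_distrib_right mult.assoc ..
  also have "agree d \<dots> (\<Sum>k\<in>{-int n..int n}. ?c k)"
    unfolding agree_def fps_sum_nth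
  proof (intro allI impI sum.cong refl)
    fix i :: nat and k :: int assume "i < d" "k \<in> {-int n..int n}"
    have "agree d (?c k * (gauss Q (n + n) (int n + k) * (\<Prod>i<n. 1 - Q ^ Suc i))) (?c k * 1)"
    proof (cases "\<bar>k\<bar> \<le> int d")
      case True
      show ?thesis
        by (intro agree_mult agree_refl agree_gauss_mult_prod Q0) (use True in \<open>auto simp: n_def\<close>)
    next
      case False
      with theta_exponent_ge[OF assms, of k] have "d \<le> nat (theta_exponent s t k)" by linarith
      then show ?thesis 
        by (auto simp: agree_def fps_X_power_mult_nth mult.assoc)
    qed
    with \<open>i < d\<close> show "fps_nth (?c k * (gauss Q (n + n) (int n + k) * (\<Prod>i<n. 1 - Q ^ Suc i))) i = fps_nth (?c k) i"
      by (simp add: agree_def)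
  qed
  also have "agree d \<dots> (qseries UNIV sgnpow (theta_exponent s t))"
    unfolding agree_def
  proof (intro allI impI)
    fix i assume "i < d"
    have "fps_nth (\<Sum>k\<in>{-int n..int n}. ?c k) i = (\<Sum>k\<in>{-int n..int n}. if theta_exponent s t k = int i then sgnpow k else 0)"
      unfolding fps_sum_nth 
    proof (intro sum.cong refl)
      fix k
      show "fps_nth (?c k) i = (if theta_exponent s t k = int i then sgnpow k else 0)"
        using e0[of k] by (auto simp: fps_X_power_nth)
    qed
    also have "\<dots> = (\<Sum>k\<in>{k\<in>{-int n..int n}. theta_exponent s t k = int i}. sgnpow k)"
      by (subst sum.inter_filter) auto
    also have "{k\<in>{-int n..int n}. theta_exponent s t k = int i} = {k\<in>UNIV. theta_exponent s t k = int i}"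
    proof -
      have "\<bar>k\<bar> \<le> int n" if "theta_exponent s t k = int i" for k
        using theta_exponent_ge[OF assms, of k] that \<open>i < d\<close> by (simp add: n_def)
      then show ?thesis by (fastforce simp: abs_le_iff)
    qed
    finally show "fps_nth (\<Sum>k\<in>{-int n..int n}. ?c k) i = fps_nth (qseries UNIV sgnpow (theta_exponent s t)) i"
      by (simp add: qseries_nth)
  qed
  finally show "agree d (qpoch_inf [fps_X ^ s, fps_X ^ t, fps_X ^ (s + t)] (fps_X ^ (s + t))) (qseries UNIV sgnpow (theta_exponent s t))"
    by (simp add: Q_def)
qed

section \<open>The quintuple product\<close>

lemma theta_exponent_even: "int s + int t = 2 * u \<Longrightarrow> theta_exponent s t k = u * (k * (k - 1)) + int s * k"
  using two_theta_exponent[of s t k] by (simp add: algebra_simps)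

text \<open>
  Sorting the factors \<open>1 - q^(M i)\<close> by \<open>i\<close> modulo \<open>3\<close> makes the right hand side a triple product; this
  turns the triple product into Euler's pentagonal number theorem.
\<close>
lemma qpoch_inf_trisect:
  assumes "M > 0"
  shows "qpoch_inf [fps_X ^ M, fps_X ^ (2 * M), fps_X ^ (3 * M)] (fps_X ^ (3 * M))
       = (qpoch_inf [fps_X ^ M] (fps_X ^ M) :: real fps)"
proof (rule agree_all_imp_eq)
  fix d :: nat
  have split: "(\<Prod>i<3 * m. f i) = (\<Prod>i<m. f (3 * i) * f (3 * i + 1) * f (3 * i + 2))" for m and f :: "nat \<Rightarrow> real fps"
  proof (induction m)
    case (Suc m)
    have "3 * Suc m = Suc (Suc (Suc (3 * m)))" by simp
    then show ?case using Suc by (simp only: prod.lessThan_Suc) (simp add: mult.assoc)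
  qed simp
  have "agree d (qpoch_inf [fps_X ^ M] (fps_X ^ M)) (\<Prod>i<3 * d. \<Prod>u\<leftarrow>[fps_X ^ M]. 1 - u * (fps_X ^ M) ^ i)"
    by (rule agree_qpoch_inf) (use assms in auto)
  also have "(\<Prod>i<3 * d. \<Prod>u\<leftarrow>[fps_X ^ M :: real fps]. 1 - u * (fps_X ^ M) ^ i)
     = (\<Prod>i<d. \<Prod>u\<leftarrow>[fps_X ^ M, fps_X ^ (2 * M), fps_X ^ (3 * M)]. 1 - u * (fps_X ^ (3 * M)) ^ i)"
    unfolding split by (simp add: mult.assoc algebra_simps flip: power_mult power_add)
  finally have "agree d (qpoch_inf [fps_X ^ M] (fps_X ^ M)) \<dots>" .
  moreover have "agree d (qpoch_inf [fps_X ^ M, fps_X ^ (2 * M), fps_X ^ (3 * M)] (fps_X ^ (3 * M)))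
     (\<Prod>i<d. \<Prod>u\<leftarrow>[fps_X ^ M, fps_X ^ (2 * M), fps_X ^ (3 * M)]. 1 - u * (fps_X ^ (3 * M)) ^ i)"
    by (rule agree_qpoch_inf) (use assms in auto)
  ultimately show "agree d (qpoch_inf [fps_X ^ M, fps_X ^ (2 * M), fps_X ^ (3 * M)] (fps_X ^ (3 * M)))
       (qpoch_inf [fps_X ^ M] (fps_X ^ M))"
    by (meson agree_sym agree_trans)
qed

lemma finite_ge_abs: "(\<And>t. F t \<ge> \<bar>t\<bar>) \<Longrightarrow> finite {t\<in>I. F t = int n}" for F :: "int \<Rightarrow> int"
proof (rule finite_subset)
  assume "\<And>t. F t \<ge> \<bar>t\<bar>"
  then show "{t\<in>I. F t = int n} \<subseteq> {-int n..int n}"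
    by (auto simp: abs_le_iff) (metis minus_le_iff)+
qed simp

text \<open>
  The exponents of the positive and the negative terms of the quintuple product series with
  \<open>z = q^(Bc)\<close> and \<open>Q = q^(2Ba)\<close>.
\<close>
definition quint_plus :: "nat \<Rightarrow> nat \<Rightarrow> nat \<Rightarrow> int \<Rightarrow> int" where
  "quint_plus a B c t = int B * (t * (3 * int a * t - int a + 3 * int c))"
definition quint_minus :: "nat \<Rightarrow> nat \<Rightarrow> nat \<Rightarrow> int \<Rightarrow> int" where
  "quint_minus a B c t = int B * ((3 * t + 1) * (int a * t + int c))"

context
  fixes a B c :: nat
  assumes pos: "B > 0" "c > 0" and ca: "c < a"
begin

lemma quint_plus_ge: "quint_plus a B c t \<ge> \<bar>t\<bar>"
proof -
  have "t * (3 * int a * t - int a + 3 * int c) \<ge> \<bar>t\<bar>"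
  proof -
    consider "t = 0" | "t \<ge> 1" | "t \<le> -1" by linarith
    then show ?thesis
    proof cases
      case 2
      have "int a * 1 \<le> int a * t" using 2 by (intro mult_left_mono) auto
      then have "3 * int a * t - int a + 3 * int c \<ge> 1" using ca pos by linarith
      then show ?thesis using mult_left_mono[of 1 _ t] 2 by fastforce
    next
      case 3
      have "int a * t \<le> int a * -1" using 3 by (intro mult_left_mono) auto
      then have "3 * int a * t - int a + 3 * int c \<le> - 1" using ca pos by linarith
      then show ?thesis using mult_left_mono_neg[of _ "-1" t] 3 by fastforce
    qed auto
  qed
  moreover have "1 * (t * (3 * int a * t - int a + 3 * int c)) \<le> int B * (t * (3 * int a * t - int a + 3 * int c))"
    by (rule mult_right_mono) (use pos calculation in auto)
  ultimately show ?thesis unfolding quint_plus_def by linarith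
qed

lemma quint_minus_ge: "quint_minus a B c t \<ge> \<bar>t\<bar>"
proof -
  have "(3 * t + 1) * (int a * t + int c) \<ge> \<bar>t\<bar>"
  proof -
    consider "t \<ge> 0" | "t \<le> -1" by linarith
    then show ?thesis
    proof cases
      case 1
      have "0 \<le> int a * t" using 1 by simp
      then have "int a * t + int c \<ge> 1" using ca pos by linarith
      then have "(3 * t + 1) * 1 \<le> (3 * t + 1) * (int a * t + int c)" using 1 by (intro mult_left_mono) auto
      then have "3 * t + 1 \<le> (3 * t + 1) * (int a * t + int c)" by (simp only: mult_1_right)
      then show ?thesis using 1 by linarith
    next
      case 2
      have "int a * t \<le> int a * -1" using 2 by (intro mult_left_mono) auto
      then have "int a * t + int c \<le> - 1" using ca pos by linarith
      then have "(3 * t + 1) * -1 \<le> (3 * t + 1) * (int a * t + int c)" using 2 by (intro mult_left_mono_neg) auto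
      then have "- (3 * t + 1) \<le> (3 * t + 1) * (int a * t + int c)" by (simp only: mult_minus_right mult_1_right)
      then show ?thesis using 2 by linarith
    qed
  qed
  moreover have "1 * ((3 * t + 1) * (int a * t + int c)) \<le> int B * ((3 * t + 1) * (int a * t + int c))"
    by (rule mult_right_mono) (use pos calculation in auto)
  ultimately show ?thesis unfolding quint_minus_def by linarith
qed

text \<open>
  Multiply the theta series in \<open>(z, Q)\<close>, with index \<open>k\<close>, by the one in \<open>(Q z^2, Q^2)\<close>, with index \<open>l\<close>,
  and collect the pairs \<open>(k, l)\<close> with the same power \<open>z^(k + 2 l)\<close>. For fixed \<open>k + 2 l\<close> the sum that remains
  is again a theta series, with base \<open>Q^6\<close>. If \<open>k + 2 l\<close> is \<open>3 t\<close> or \<open>3 t + 1\<close>, it is, up to sign and a power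
  of \<open>Q\<close>, the pentagonal series for \<open>Q^2\<close>, independently of \<open>t\<close>; if \<open>k + 2 l = 3 t + 2\<close>, it vanishes because
  the involution \<open>l \<mapsto> 2 t + 1 - l\<close> reverses the sign.
\<close>
lemma theta_product_eq:
  "qseries UNIV sgnpow (theta_exponent (B * c) (B * (2 * a - c))) * qseries UNIV sgnpow (theta_exponent (2 * B * (a + c)) (2 * B * (a - c)))
   = qseries UNIV sgnpow (theta_exponent (4 * B * a) (8 * B * a)) * (qseries UNIV (\<lambda>_. 1) (quint_plus a B c) - qseries UNIV (\<lambda>_. 1) (quint_minus a B c))"
proof -
  let ?J1 = "theta_exponent (B * c) (B * (2 * a - c))" and ?J2 = "theta_exponent (2 * B * (a + c)) (2 * B * (a - c))"
  let ?P = "theta_exponent (4 * B * a) (8 * B * a)"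
  let ?E1 = "quint_plus a B c" and ?E2 = "quint_minus a B c"
  have J1: "?J1 k = int B * int a * (k * (k - 1)) + int B * int c * k" for k
    using ca by (subst theta_exponent_even[of _ _ "int B * int a"]) (auto simp: algebra_simps of_nat_diff)
  have J2: "?J2 l = 2 * int B * int a * (l * (l - 1)) + 2 * int B * (int a + int c) * l" for l
    using ca by (subst theta_exponent_even[of _ _ "2 * int B * int a"]) (auto simp: algebra_simps of_nat_diff)
  have P: "?P j = 6 * int B * int a * (j * (j - 1)) + 4 * int B * int a * j" for j
    by (subst theta_exponent_even[of _ _ "6 * int B * int a"]) (auto simp: algebra_simps)
  have ge1: "?J1 k \<ge> \<bar>k\<bar>" and ge2: "?J2 k \<ge> \<bar>k\<bar>" and geP: "?P k \<ge> \<bar>k\<bar>" for k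
    by (rule theta_exponent_ge; use pos ca in simp)+
  have nn: "?J1 k \<ge> 0" "?J2 k \<ge> 0" "?P k \<ge> 0" "?E1 k \<ge> 0" "?E2 k \<ge> 0" for k
    using ge1[of k] ge2[of k] geP[of k] quint_plus_ge[of k] quint_minus_ge[of k] by linarith+
  note fin = finite_ge_abs[of ?J1, OF ge1] finite_ge_abs[of ?J2, OF ge2] finite_ge_abs[of ?P, OF geP]
    finite_ge_abs[of ?E1, OF quint_plus_ge] finite_ge_abs[of ?E2, OF quint_minus_ge]
  define W where "W = (\<lambda>(k, l). sgnpow k * sgnpow l)"
  define E where "E = (\<lambda>(k, l). ?J1 k + ?J2 l)"
  define I where "I r = {(k :: int, l :: int). (k + 2 * l) mod 3 = r}" for r
  have fU: "finite {p\<in>UNIV \<times> UNIV. E p = int n}" for n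
    unfolding E_def by (rule qseries_mult_finite) (rule nn fin)+
  then have fS: "finite {p\<in>S. E p = int n}" for n S
    by (rule finite_subset[rotated]) auto
  have "qseries UNIV sgnpow ?J1 * qseries UNIV sgnpow ?J2 = qseries (UNIV \<times> UNIV) W E"
    unfolding W_def E_def by (rule qseries_mult) (rule nn fin)+
  also have "UNIV \<times> UNIV = I 0 \<union> I 1 \<union> I 2"
    by (auto simp: I_def)
  also have "qseries (I 0 \<union> I 1 \<union> I 2) W E = qseries (I 0) W E + qseries (I 1) W E + qseries (I 2) W E"
    by (subst qseries_Un, force simp: I_def, rule fS, subst qseries_Un, force simp: I_def, rule fS, rule refl)
  also have "qseries (I 0) W E = qseries (UNIV \<times> UNIV) (\<lambda>(j, t). sgnpow j * 1) (\<lambda>(j, t). ?P j + ?E1 t)"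
  proof (rule qseries_reindex)
    show "bij_betw (\<lambda>(j, t). (t + 2 * j, t - j)) (UNIV \<times> UNIV) (I 0)"
      by (rule bij_betw_byWitness[where f' = "\<lambda>(k, l). ((k + 2 * l) div 3 - l, (k + 2 * l) div 3)"])
         (auto simp: I_def)
  next
    fix p :: "int \<times> int"
    show "(case p of (j, t) \<Rightarrow> sgnpow j * 1) = W (case p of (j, t) \<Rightarrow> (t + 2 * j, t - j))"
      by (auto simp: W_def sgnpow_def split: prod.splits)
    show "(case p of (j, t) \<Rightarrow> ?P j + ?E1 t) = E (case p of (j, t) \<Rightarrow> (t + 2 * j, t - j))"
      by (cases p, simp only: E_def prod.case J1 J2 P quint_plus_def) (simp add: algebra_simps)
  qed
  also have "qseries (I 1) W E = qseries (UNIV \<times> UNIV) (\<lambda>(j, t). sgnpow j * (-1)) (\<lambda>(j, t). ?P j + ?E2 t)"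
  proof (rule qseries_reindex)
    show "bij_betw (\<lambda>(j, t). (t + 1 - 2 * j, t + j)) (UNIV \<times> UNIV) (I 1)"
      by (rule bij_betw_byWitness[where f' = "\<lambda>(k, l). (l - (k + 2 * l) div 3, (k + 2 * l) div 3)"])
         (auto simp: I_def; presburger)+
  next
    fix p :: "int \<times> int"
    show "(case p of (j, t) \<Rightarrow> sgnpow j * (-1)) = W (case p of (j, t) \<Rightarrow> (t + 1 - 2 * j, t + j))"
      by (auto simp: W_def sgnpow_def split: prod.splits)
    show "(case p of (j, t) \<Rightarrow> ?P j + ?E2 t) = E (case p of (j, t) \<Rightarrow> (t + 1 - 2 * j, t + j))"
      by (cases p, simp only: E_def prod.case J1 J2 P quint_minus_def) (simp add: algebra_simps)
  qed
  \<comment> \<open>The map \<open>?h\<close> fixes \<open>k + 2 l = 3 t + 2\<close> and sends \<open>l\<close> to \<open>2 t + 1 - l\<close>.\<close>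
  also have "qseries (I 2) W E = 0"
  proof -
    let ?h = "\<lambda>(k, l). (k - 2 * (2 * ((k + 2 * l) div 3) + 1 - 2 * l), 2 * ((k + 2 * l) div 3) + 1 - l) :: int \<times> int"
    have "qseries (I 2) W E = qseries (I 2) (\<lambda>p. - W p) E"
    proof (rule qseries_reindex)
      show "bij_betw ?h (I 2) (I 2)"
        by (rule bij_betw_byWitness[where f' = ?h]) (auto simp: I_def; presburger)+
    next
      fix p assume "p \<in> I 2"
      then obtain k l where p: "p = (k, l)" and kl: "(k + 2 * l) mod 3 = 2" by (auto simp: I_def)
      define t where "t = (k + 2 * l) div 3"
      have k: "k = 3 * t + 2 - 2 * l" using kl unfolding t_def by presburger
      have h: "?h p = (k - 2 * (2 * t + 1 - 2 * l), 2 * t + 1 - l)" by (simp add: p t_def)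
      show "- W p = W (?h p)" unfolding h by (auto simp: p W_def sgnpow_def)
      show "E p = E (?h p)" unfolding h by (simp only: p E_def J1 J2 k prod.case) (simp add: algebra_simps)
    qed
    then show ?thesis by (simp add: qseries_uminus eq_neg_iff_add_eq_0)
  qed
  also have "qseries (UNIV \<times> UNIV) (\<lambda>(j, t). sgnpow j * 1) (\<lambda>(j, t). ?P j + ?E1 t) = qseries UNIV sgnpow ?P * qseries UNIV (\<lambda>_. 1) ?E1"
    by (rule qseries_mult[symmetric]) (rule nn fin)+
  also have "qseries (UNIV \<times> UNIV) (\<lambda>(j, t). sgnpow j * (-1)) (\<lambda>(j, t). ?P j + ?E2 t) = qseries UNIV sgnpow ?P * qseries UNIV (\<lambda>_. - 1) ?E2"
    by (rule qseries_mult[symmetric]) (rule nn fin)+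
  also have "qseries UNIV (\<lambda>_. - 1) ?E2 = - qseries UNIV (\<lambda>_. 1) ?E2"
    by (rule qseries_uminus)
  finally show ?thesis by (simp add: algebra_simps)
qed

text \<open>
  Both sides multiplied by \<open>(Q^2;Q^2)\<close> are products of theta series. The factor completes the second product
  to a triple product, and by the pentagonal number theorem it equals the third theta series.
\<close>
theorem quintuple_product:
  "qpoch_inf [fps_X ^ (B * c), fps_X ^ (B * (2 * a - c)), fps_X ^ (2 * B * a)] (fps_X ^ (2 * B * a))
     * qpoch_inf [fps_X ^ (2 * B * (a + c)), fps_X ^ (2 * B * (a - c))] (fps_X ^ (4 * B * a))
   = qseries UNIV (\<lambda>_. 1) (quint_plus a B c) - qseries UNIV (\<lambda>_. 1) (quint_minus a B c)"
    (is "?L1 * ?L2 = ?R")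
proof -
  let ?D = "qpoch_inf [fps_X ^ (4 * B * a)] (fps_X ^ (4 * B * a)) :: real fps"
  have a: "a > 0" using ca by simp
  have "c + (2 * a - c) = 2 * a" "(a + c) + (a - c) = 2 * a" using ca by linarith+
  then have eq1: "B * c + B * (2 * a - c) = 2 * B * a"
    and eq2: "2 * B * (a + c) + 2 * B * (a - c) = 4 * B * a"
    unfolding distrib_left[symmetric] by simp_all
  have eq3: "4 * B * a + 8 * B * a = 12 * B * a" "2 * (4 * B * a) = 8 * B * a" "3 * (4 * B * a) = 12 * B * a"
    by simp_all
  have 1: "?L1 = qseries UNIV sgnpow (theta_exponent (B * c) (B * (2 * a - c)))"
    by (rule jacobi_triple_product[of "B * c" "B * (2 * a - c)", unfolded eq1]) (use pos ca in auto)
  have "?L2 * ?D = qpoch_inf ([fps_X ^ (2 * B * (a + c)), fps_X ^ (2 * B * (a - c))] @ [fps_X ^ (4 * B * a)]) (fps_X ^ (4 * B * a))"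
    by (rule qpoch_inf_append[symmetric]) (use pos ca in auto)
  also have "\<dots> = qseries UNIV sgnpow (theta_exponent (2 * B * (a + c)) (2 * B * (a - c)))"
    unfolding append_Cons append_Nil
    by (rule jacobi_triple_product[of "2 * B * (a + c)" "2 * B * (a - c)", unfolded eq2]) (use pos ca in auto)
  finally have 2: "?L2 * ?D = qseries UNIV sgnpow (theta_exponent (2 * B * (a + c)) (2 * B * (a - c)))" .
  have "qseries UNIV sgnpow (theta_exponent (4 * B * a) (8 * B * a))
      = qpoch_inf [fps_X ^ (4 * B * a), fps_X ^ (8 * B * a), fps_X ^ (12 * B * a)] (fps_X ^ (12 * B * a))"
    by (rule jacobi_triple_product[of "4 * B * a" "8 * B * a", unfolded eq3, symmetric]) (use pos a in auto)
  also have "\<dots> = ?D"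
    by (rule qpoch_inf_trisect[of "4 * B * a", unfolded eq3]) (use pos a in auto)
  finally have 3: "qseries UNIV sgnpow (theta_exponent (4 * B * a) (8 * B * a)) = ?D" .
  have "(?L1 * ?L2) * ?D = ?R * ?D"
    using theta_product_eq unfolding 1 2[symmetric] 3 by (simp add: algebra_simps)
  moreover have "fps_nth ?D 0 = 1" by (rule qpoch_inf_nth_0) (use pos a in auto)
  then have "?D \<noteq> 0" by auto
  ultimately show ?thesis by simp
qed

end

section \<open>Gaussian binomials and partition numbers coefficientwise\<close>

definition partition_coeff :: "int \<Rightarrow> real" where
  "partition_coeff e = (if e < 0 then 0 else fps_nth (inverse (qpoch_inf [fps_X] fps_X)) (nat e))"

text \<open>
  Coefficients are indexed by integers and vanish at negative indices. Multiplication by \<open>q^N\<close> is then the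
  shift \<open>e \<mapsto> e - N\<close> even for negative \<open>N\<close>, and the Pascal rules hold without conditions.
\<close>
definition gauss_coeff :: "nat \<Rightarrow> int \<Rightarrow> int \<Rightarrow> real" where
  "gauss_coeff A k e = (if e < 0 then 0 else fps_nth (gauss fps_X A k) (nat e))"

lemma gauss_coeff_eq_0: "k < 0 \<or> k > int A \<Longrightarrow> gauss_coeff A k e = 0"
  by (simp add: gauss_coeff_def gauss_eq_0)

lemma gauss_coeff_neg: "e < 0 \<Longrightarrow> gauss_coeff A k e = 0"
  by (simp add: gauss_coeff_def)

lemma gauss_coeff_0: "gauss_coeff 0 k e = (if k = 0 \<and> e = 0 then 1 else 0)"
  by (auto simp: gauss_coeff_def)

lemma gauss_coeff_symm: "gauss_coeff A (int A - k) e = gauss_coeff A k e"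
  by (simp add: gauss_coeff_def gauss_symm)

lemma X_power_mult_coeff:
  "j \<ge> 0 \<Longrightarrow> e \<ge> 0 \<Longrightarrow> fps_nth (fps_X ^ nat j * f) (nat e) = (if e - j < 0 then 0 else fps_nth (f :: real fps) (nat (e - j)))"
  by (auto simp: fps_X_power_mult_nth nat_diff_distrib')

lemma gauss_coeff_Suc: "gauss_coeff (Suc A) k e = gauss_coeff A (k - 1) e + gauss_coeff A k (e - k)"
proof (cases "k \<ge> 0 \<and> e \<ge> 0")
  case True
  then show ?thesis by (simp add: gauss_coeff_def X_power_mult_coeff)
next
  case False
  then show ?thesis 
    by (cases "k < 0") (simp_all add: gauss_coeff_eq_0 gauss_coeff_neg)
qed

lemma gauss_coeff_Suc': "gauss_coeff (Suc A) k e = gauss_coeff A k e + gauss_coeff A (k - 1) (e - (int A + 1 - k))"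
proof (cases "k \<le> int A + 1 \<and> e \<ge> 0")
  case True
  then show ?thesis by (simp add: gauss_coeff_def gauss_Suc' X_power_mult_coeff del: gauss.simps)
next
  case False
  then show ?thesis
    by (cases "k \<le> int A + 1") (simp_all add: gauss_coeff_eq_0 gauss_coeff_neg)
qed

lemma gauss_coeff_stable:
  assumes "e < d" "d \<le> k" "d \<le> int A - k"
  shows "gauss_coeff A k e = partition_coeff e"
proof (cases "e < 0")
  case False
  define d' where "d' = nat d"
  let ?q = "qpoch_inf [fps_X] fps_X :: real fps"
  have q0: "fps_nth ?q 0 = 1" by (rule qpoch_inf_nth_0) auto
  have "agree d' ?q (\<Prod>i<d'. \<Prod>u\<leftarrow>[fps_X]. 1 - u * fps_X ^ i)"
    by (rule agree_qpoch_inf) auto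
  then have "agree d' (gauss fps_X A k * ?q) (gauss fps_X A k * (\<Prod>i<d'. 1 - fps_X ^ Suc i))"
    by (intro agree_mult) simp_all
  also have "agree d' \<dots> 1"
    by (rule agree_gauss_mult_prod) (use assms False in \<open>auto simp: d'_def\<close>)
  finally have "agree d' (gauss fps_X A k * ?q * inverse ?q) (1 * inverse ?q)"
    by (rule agree_mult) simp
  moreover have "?q * inverse ?q = 1" using q0 by (intro inverse_mult_eq_1') simp
  ultimately have "agree d' (gauss fps_X A k) (inverse ?q)" by (simp add: mult.assoc)
  then show ?thesis using assms False
    by (auto simp: agree_def gauss_coeff_def partition_coeff_def d'_def)
qed (simp add: partition_coeff_def gauss_coeff_def)

section \<open>Theta series divided by the partition product\<close>

text \<open>
  The coefficient of \<open>q^y\<close> in \<open>(\<Sum>t. q^(E t)) / (q;q)\<close>.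
\<close>
definition theta_quotient_coeff :: "(int \<Rightarrow> int) \<Rightarrow> int \<Rightarrow> real" where
  "theta_quotient_coeff E y = (\<Sum>t | E t \<le> y. partition_coeff (y - E t))"

lemma theta_quotient_coeff_reindex:
  assumes "bij h" "\<And>t. F t = E (h t) + d"
  shows "theta_quotient_coeff F y = theta_quotient_coeff E (y - d)"
proof -
  have "bij_betw h {t. F t \<le> y} {t. E t \<le> y - d}"
    using assms(1) by (auto simp: bij_betw_def inj_on_def bij_def assms(2) image_iff le_diff_eq)
  then have "theta_quotient_coeff E (y - d) = (\<Sum>t | F t \<le> y. partition_coeff (y - d - E (h t)))"
    unfolding theta_quotient_coeff_def by (rule sum.reindex_bij_betw[symmetric])
  then show ?thesis by (simp add: theta_quotient_coeff_def assms(2) algebra_simps)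
qed

section \<open>Positivity of the hook difference polynomials\<close>

text \<open>
  The coefficient of \<open>q^e\<close> in the hook difference polynomial
  \<open>\<Sum>\<mu>. q^(\<mu> (p p' \<mu> + r p' - p s)) [A; N - p \<mu>] - \<Sum>\<mu>. q^((p \<mu> - r) (p' \<mu> - s)) [A; N - p \<mu> + r]\<close>,
  where \<open>[A; k]\<close> is a Gaussian binomial. The sums are cut off at \<open>\<bar>\<mu>\<bar> \<le> L\<close>; with a cut-off that does not
  depend on the other parameters the Pascal rules can be applied term by term.
\<close>
definition hook_diff :: "int \<Rightarrow> int \<Rightarrow> int \<Rightarrow> int \<Rightarrow> nat \<Rightarrow> int \<Rightarrow> int \<Rightarrow> int \<Rightarrow> real" where
  "hook_diff p p' L r A N s e = 
     (\<Sum>\<mu>\<in>{-L..L}. gauss_coeff A (N - p * \<mu>) (e - \<mu> * (p * p' * \<mu> + r * p' - p * s)))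
   - (\<Sum>\<mu>\<in>{-L..L}. gauss_coeff A (N - p * \<mu> + r) (e - (p * \<mu> - r) * (p' * \<mu> - s)))"

text \<open>
  In the Pascal rule with the factor \<open>q^(N - p \<mu>)\<close> the part \<open>q^(- p \<mu>)\<close> is absorbed into the
  exponent by replacing \<open>s\<close> by \<open>s + 1\<close>; the second sum behaves consistently. In the mirrored rule
  \<open>s\<close> becomes \<open>s - 1\<close>.
\<close>
lemma hook_diff_Suc:
  "hook_diff p p' L r (Suc A) N s e = hook_diff p p' L r A (N - 1) s e + hook_diff p p' L r A N (s + 1) (e - N)"
  unfolding hook_diff_def gauss_coeff_Suc
  by (simp add: sum.distrib algebra_simps)

lemma hook_diff_Suc':
  "hook_diff p p' L r (Suc A) N s e = hook_diff p p' L r A N s e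
     + hook_diff p p' L r A (N - 1) (s - 1) (e - (int A + 1 - N))"
  unfolding hook_diff_def gauss_coeff_Suc'
  by (simp add: sum.distrib algebra_simps)

text \<open>
  On this edge the two sums are exchanged by \<open>\<mu> \<mapsto> - \<mu>\<close> and the symmetry of the Gaussian binomial.
\<close>
lemma hook_diff_lower:
  assumes "2 * N - int A = - r"
  shows "hook_diff p p' L r A N 0 e = 0"
proof -
  have A: "N - p * (- \<mu>) + r = int A - (N - p * \<mu>)" for \<mu> using assms by simp
  have "(\<Sum>\<mu>\<in>{-L..L}. gauss_coeff A (N - p * \<mu> + r) (e - (p * \<mu> - r) * (p' * \<mu> - 0)))
      = (\<Sum>\<mu>\<in>{-L..L}. gauss_coeff A (N - p * (-\<mu>) + r) (e - (p * (-\<mu>) - r) * (p' * (-\<mu>) - 0)))"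
    by (rule sum.reindex_bij_witness[of _ uminus uminus]) auto
  also have "\<dots> = (\<Sum>\<mu>\<in>{-L..L}. gauss_coeff A (N - p * \<mu>) (e - \<mu> * (p * p' * \<mu> + r * p' - p * 0)))"
    unfolding A gauss_coeff_symm by (simp add: algebra_simps)
  finally show ?thesis by (simp add: hook_diff_def)
qed

text \<open>
  On the opposite edge the sums are exchanged by \<open>\<mu> \<mapsto> 1 - \<mu>\<close>. This map moves the range of
  summation by one, so the cut-off must be large enough for the terms at the ends to vanish.
\<close>
lemma hook_diff_upper:
  assumes "2 * N - int A = p - r" "int A < L" "0 < p" "0 \<le> r" "r \<le> p"
  shows "hook_diff p p' L r A N p' e = 0"
proof -
  let ?f = "\<lambda>\<mu>. gauss_coeff A (N - p * \<mu> + r) (e - (p * \<mu> - r) * (p' * \<mu> - p'))"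
  have A: "N - p * (1 - \<mu>) + r = int A - (N - p * \<mu>)" for \<mu> using assms(1) by (simp add: algebra_simps)
  have pL: "p * L \<ge> L" using assms mult_right_mono[of 1 p L] by simp
  have "?f (-L) = 0"
    by (rule gauss_coeff_eq_0, rule disjI2) (use assms pL in \<open>simp only: mult_minus_right; linarith\<close>)
  moreover have "?f (1 + L) = 0"
    by (rule gauss_coeff_eq_0, rule disjI1) (use assms pL in \<open>simp only: distrib_left mult_1_right; linarith\<close>)
  moreover have "sum ?f {-L..L} = ?f (-L) + sum ?f {1-L..L}"
    using assms by (subst sum.remove[of _ "-L"]) (auto intro!: arg_cong[of _ _ "sum ?f"])
  moreover have "sum ?f {1-L..1+L} = ?f (1+L) + sum ?f {1-L..L}"
    using assms by (subst sum.remove[of _ "1+L"]) (auto intro!: arg_cong[of _ _ "sum ?f"])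
  ultimately have "sum ?f {-L..L} = sum ?f {1-L..1+L}" by simp
  also have "\<dots> = (\<Sum>\<mu>\<in>{-L..L}. ?f (1 - \<mu>))"
    by (rule sum.reindex_bij_witness[of _ "\<lambda>\<mu>. 1 - \<mu>" "\<lambda>\<mu>. 1 - \<mu>"]) auto
  also have "\<dots> = (\<Sum>\<mu>\<in>{-L..L}. gauss_coeff A (N - p * \<mu>) (e - \<mu> * (p * p' * \<mu> + r * p' - p * p')))"
    unfolding A gauss_coeff_symm by (simp add: algebra_simps)
  finally show ?thesis by (simp add: hook_diff_def)
qed

text \<open>
  The region is \<open>0 \<le> s \<le> p'\<close> with \<open>2 N - A\<close> between \<open>s - r\<close> and \<open>p - p' + s - r\<close>. Away from the lower end of
  the interval and for \<open>s < p'\<close>, the first recurrence leads to two points of the region; away from the upper end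
  and for \<open>s > 0\<close>, the mirrored one does. As \<open>p' < p\<close> the two ends are distinct, so the only points
  with neither option are the two corners where the polynomial is \<open>0\<close>. For \<open>A = 0\<close> a negative term occurs only at
  these corners.
\<close>
lemma hook_diff_nonneg:
  assumes "0 < p'" "p' < p" "0 \<le> r" "r \<le> p"
  assumes "0 \<le> s" "s \<le> p'" "s - r \<le> 2 * N - int A" "2 * N - int A \<le> p - p' + s - r" "int A < L"
  shows "hook_diff p p' L r A N s e \<ge> 0"
  using assms(5-)
proof (induction A arbitrary: N s e)
  case 0
  consider "s = 0" "2 * N - int 0 = - r" | "s = p'" "2 * N - int 0 = p - r"
    | "\<not> (s = 0 \<and> 2 * N = - r)" "\<not> (s = p' \<and> 2 * N = p - r)" by auto
  then show ?case
  proof cases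
    case 1
    then show ?thesis using hook_diff_lower by simp
  next
    case 2
    then show ?thesis using hook_diff_upper[of N 0 p r L p' e] 0 assms by simp
  next
    case 3
    have "N - p * \<mu> + r \<noteq> 0" for \<mu>
    proof
      assume "N - p * \<mu> + r = 0"
      then have N: "N = p * \<mu> - r" by simp
      have bnd: "s - r \<le> 2 * N" "2 * N \<le> p - p' + s - r" using 0 by simp_all
      consider "\<mu> \<le> -1" | "\<mu> = 0" | "\<mu> = 1" | "\<mu> \<ge> 2" by linarith
      then show False
      proof cases
        case 1
        then have "p * \<mu> \<le> p * -1" using assms by (intro mult_left_mono) auto
        then show False using N bnd 0(1,2) assms(1-4) by linarith
      next
        case 2
        then show False using N 0 3 assms(1-4) by simp
      next
        case 3
        then show False using N 0 \<open>\<not> (s = p' \<and> 2 * N = p - r)\<close> assms(1-4) by simp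
      next
        case 4
        then have "p * \<mu> \<ge> p * 2" using assms by (intro mult_left_mono) auto
        then show False using N bnd 0(1,2) assms(1-4) by linarith
      qed
    qed
    then have "hook_diff p p' L r 0 N s e
       = (\<Sum>\<mu>\<in>{-L..L}. gauss_coeff 0 (N - p * \<mu>) (e - \<mu> * (p * p' * \<mu> + r * p' - p * s)))"
      by (simp add: hook_diff_def gauss_coeff_0)
    also have "\<dots> \<ge> 0" by (intro sum_nonneg) (simp add: gauss_coeff_0)
    finally show ?thesis .
  qed
next
  case (Suc A)
  consider "s = 0" "2 * N - int (Suc A) = - r" | "s = p'" "2 * N - int (Suc A) = p - r"
    | "s < p'" "s - r < 2 * N - int (Suc A)"
    | "s > 0" "2 * N - int (Suc A) < p - p' + s - r"
    using Suc.prems assms(1-4) by linarith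
  then show ?case
  proof cases
    case 1
    then show ?thesis using hook_diff_lower by simp
  next
    case 2
    then show ?thesis using hook_diff_upper[of N "Suc A" p r L p' e] Suc.prems assms by simp
  next
    case 3
    have "hook_diff p p' L r A (N - 1) s e \<ge> 0" "hook_diff p p' L r A N (s + 1) (e - N) \<ge> 0"
      by - (rule Suc.IH; use Suc.prems assms(1-4) 3 in simp)+
    then show ?thesis unfolding hook_diff_Suc by linarith
  next
    case 4
    have "hook_diff p p' L r A N s e \<ge> 0" "hook_diff p p' L r A (N - 1) (s - 1) (e - (int A + 1 - N)) \<ge> 0"
      by - (rule Suc.IH; use Suc.prems assms(1-4) 4 in simp)+
    then show ?thesis unfolding hook_diff_Suc' by linarith
  qed
qed

section \<open>Constancy of sign\<close>

text \<open>
  The coefficients of the Rocha-Caridi expression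
  \<open>(\<Sum>t. q^(t (p p' t + r p' - p s)) - \<Sum>t. q^((p t + r) (p' t + s))) / (q;q)\<close> with arbitrary integers \<open>r\<close> and \<open>s\<close>.
\<close>
definition virasoro_coeff :: "int \<Rightarrow> int \<Rightarrow> int \<Rightarrow> int \<Rightarrow> int \<Rightarrow> real" where
  "virasoro_coeff p p' r s y = theta_quotient_coeff (\<lambda>t. t * (p * p' * t + r * p' - p * s)) y - theta_quotient_coeff (\<lambda>t. (p * t + r) * (p' * t + s)) y"

text \<open>
  Only indices with \<open>E t \<le> y < d\<close> matter, hence \<open>\<bar>t\<bar> \<le> d\<close>; there the Gaussian binomials
  already have the coefficients of \<open>1 / (q;q)\<close>.
\<close>
lemma theta_quotient_coeff_eq_gauss_sum:
  assumes "\<And>t. \<bar>t\<bar> - 1 \<le> E t" "y < d" "d \<le> L" 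
    and nonneg: "\<And>t. 0 \<le> E t"
    and "\<And>t. \<bar>t\<bar> \<le> d \<Longrightarrow> d \<le> k t \<and> d \<le> int A - k t"
  shows "theta_quotient_coeff E y = (\<Sum>t\<in>{-L..L}. gauss_coeff A (k t) (y - E t))"
proof -
  have t: "\<bar>t\<bar> \<le> d" if "E t \<le> y" for t using assms(1)[of t] assms(2) that by linarith
  have sub: "{t. E t \<le> y} \<subseteq> {-L..L}" using t assms(3) by (fastforce simp: abs_le_iff)
  have "theta_quotient_coeff E y = (\<Sum>t | E t \<le> y. gauss_coeff A (k t) (y - E t))"
    unfolding theta_quotient_coeff_def
  proof (intro sum.cong refl)
    fix t assume "t \<in> {t. E t \<le> y}"
    then have "E t \<le> y" by simp
    show "partition_coeff (y - E t) = gauss_coeff A (k t) (y - E t)"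
      by (intro gauss_coeff_stable[symmetric, of _ d]) (use t[OF \<open>E t \<le> y\<close>] assms(2) assms(5)[of t] nonneg[of t] in auto)
  qed
  also have "\<dots> = (\<Sum>t\<in>{-L..L}. gauss_coeff A (k t) (y - E t))"
    by (intro sum.mono_neutral_left sub) (auto intro!: gauss_coeff_neg)
  finally show ?thesis .
qed

text \<open>
  Let \<open>A\<close> and \<open>N\<close> grow along the line \<open>2 N - A = s - r\<close>, the lower end of the admissible interval: the
  hook difference polynomials then tend to the series in question.
\<close>
lemma virasoro_coeff_nonneg_fundamental:
  assumes p: "0 < p'" "p' < p" and r: "0 \<le> r" "r \<le> p" and s: "0 \<le> s" "s \<le> p'"
  shows "virasoro_coeff p p' r s y \<ge> 0"
proof -
  let ?E1 = "\<lambda>t. t * (p * p' * t + r * p' - p * s)" and ?E2 = "\<lambda>t. (p * t - r) * (p' * t - s)"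
  have E1: "?E1 t \<ge> 0 \<and> ?E1 t \<ge> \<bar>t\<bar> - 1" for t
  proof -
    have rp: "0 \<le> r * p'" "r * p' \<le> p * p'" "0 \<le> p * s" "p * s \<le> p * p'" 
      using p r s by (auto intro: mult_right_mono mult_left_mono)
    have pp: "p * p' \<ge> 1" using p mult_mono[of 1 p 1 p'] by simp
    consider "t = 0" | "t \<ge> 1" | "t \<le> -1" by linarith
    then show ?thesis
    proof cases
      case 2
      have "1 * (t - 1) \<le> p * p' * (t - 1)" using pp 2 by (intro mult_right_mono) auto
      then have "t - 1 \<le> p * p' * t + r * p' - p * s" using rp by (simp add: algebra_simps)
      then have "1 * (t - 1) \<le> ?E1 t" using 2 by (intro mult_mono) auto
      then have "t - 1 \<le> ?E1 t" by (simp only: mult_1_left)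
      then show ?thesis using 2 by (intro conjI) linarith+
    next
      case 3
      have "p * p' * (t + 1) \<le> 1 * (t + 1)" using pp 3 by (intro mult_right_mono_neg) auto
      then have "p * p' * t + r * p' - p * s \<le> t + 1" using rp by (simp add: algebra_simps)
      then have "1 * (- t - 1) \<le> (- t) * - (p * p' * t + r * p' - p * s)" using 3 by (intro mult_mono) auto
      then have "- t - 1 \<le> ?E1 t" by (simp only: mult_1_left minus_mult_minus)
      then show ?thesis using 3 by (intro conjI) linarith+
    qed auto
  qed
  have E2: "?E2 t \<ge> 0 \<and> ?E2 t \<ge> \<bar>t\<bar> - 1" for t
  proof (cases "t \<ge> 1")
    case True
    have "1 * (t - 1) \<le> p * (t - 1)" "1 * (t - 1) \<le> p' * (t - 1)"
      using p True by (intro mult_right_mono; simp)+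
    then have 1: "t - 1 \<le> p * t - r" "t - 1 \<le> p' * t - s" using r s by (simp_all add: algebra_simps)
    have "(t - 1) * (t - 1) \<le> ?E2 t" using True 1 by (intro mult_mono) auto
    moreover have "(t - 1) * (t - 1) \<ge> t - 1" 
      using mult_left_mono[of 1 "t - 1" "t - 1"] True by (cases "t = 1") auto
    ultimately show ?thesis using True by (intro conjI) linarith+
  next
    case False
    then have "p * t \<le> 1 * t" "p' * t \<le> 1 * t"
      using p by (intro mult_right_mono_neg; simp)+
    then have 1: "-t \<le> -(p * t - r)" "-t \<le> -(p' * t - s)" using r s by simp_all
    have "-t * -t \<le> -(p * t - r) * -(p' * t - s)" using False 1 by (intro mult_mono) auto
    moreover have "-t * -t \<ge> -t" 
      using mult_left_mono[of 1 "-t" "-t"] False by (cases "t = 0") auto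
    ultimately have "- t \<le> ?E2 t" by (simp only: minus_mult_minus)
    then show ?thesis using False by (intro conjI) linarith+
  qed
  \<comment> \<open>With these \<open>A\<close> and \<open>N\<close> all lower indices that belong to \<open>\<bar>t\<bar> \<le> d\<close> keep distance \<open>d\<close> from both ends of row \<open>A\<close>.\<close>
  define d where "d = max y 0 + 1"
  have d: "d \<ge> 1" "y < d" by (auto simp: d_def)
  define N where "N = p * d + d + p'"
  define A where "A = nat (2 * N - s + r)"
  define L where "L = int A + 1"
  have "p * d \<ge> 0" using p d by simp
  then have "2 * N - s + r \<ge> d" unfolding N_def distrib_left using p r s d by linarith
  then have A: "int A = 2 * N - s + r" and L: "d \<le> L" using d by (simp_all add: A_def L_def)
  have k: "-(p * d) \<le> p * t \<and> p * t \<le> p * d" if "\<bar>t\<bar> \<le> d" for t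
    using that p mult_left_mono[of t d p] mult_left_mono[of "-d" t p] by (auto simp: abs_le_iff)
  have k': "d \<le> N - p * t \<and> d \<le> int A - (N - p * t)"
      "d \<le> N - p * t + r \<and> d \<le> int A - (N - p * t + r)" if "\<bar>t\<bar> \<le> d" for t
    using k[OF that] p r s A unfolding N_def distrib_left by linarith+
  have "theta_quotient_coeff ?E1 y = (\<Sum>t\<in>{-L..L}. gauss_coeff A (N - p * t) (y - ?E1 t))"
    by (rule theta_quotient_coeff_eq_gauss_sum[of _ _ d]) (use E1 d(2) L k' in auto)
  moreover have "theta_quotient_coeff ?E2 y = (\<Sum>t\<in>{-L..L}. gauss_coeff A (N - p * t + r) (y - ?E2 t))"
    by (rule theta_quotient_coeff_eq_gauss_sum[of _ _ d]) (use E2 d(2) L k' in auto)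
  moreover have "hook_diff p p' L r A N s y \<ge> 0"
    by (rule hook_diff_nonneg) (use p r s A in \<open>auto simp: L_def\<close>)
  moreover have "theta_quotient_coeff (\<lambda>t. (p * t + r) * (p' * t + s)) y = theta_quotient_coeff ?E2 (y - 0)"
    by (rule theta_quotient_coeff_reindex[of uminus]) (auto simp: algebra_simps intro!: bij_uminus)
  ultimately show ?thesis by (simp add: virasoro_coeff_def hook_diff_def)
qed

text \<open>
  Substitutions in the summation index show: translating \<open>(r, s)\<close> by the lattice
  spanned by \<open>(2 p, 0)\<close> and \<open>(p, p')\<close> multiplies both sums by the same power of \<open>q\<close>, and
  \<open>r \<mapsto> - r\<close> interchanges them up to such a power.
\<close>
lemma virasoro_coeff_shift_r:
  "virasoro_coeff p p' (r + 2 * p * k) s y = virasoro_coeff p p' r s (y + k * (p * p' * k + r * p' - p * s))"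
proof -
  have "theta_quotient_coeff (\<lambda>t. t * (p * p' * t + (r + 2 * p * k) * p' - p * s)) y
      = theta_quotient_coeff (\<lambda>t. t * (p * p' * t + r * p' - p * s)) (y - - (k * (p * p' * k + r * p' - p * s)))"
    by (rule theta_quotient_coeff_reindex[of "\<lambda>t. t + k"]) (auto simp: algebra_simps intro!: bij_plus_right)
  moreover have "theta_quotient_coeff (\<lambda>t. (p * t + (r + 2 * p * k)) * (p' * t + s)) y
      = theta_quotient_coeff (\<lambda>t. (p * t + r) * (p' * t + s)) (y - - (k * (p * p' * k + r * p' - p * s)))"
    by (rule theta_quotient_coeff_reindex[of "\<lambda>t. t + k"]) (auto simp: algebra_simps intro!: bij_plus_right)
  ultimately show ?thesis by (simp add: virasoro_coeff_def)
qed

lemma virasoro_coeff_shift_both: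
  "virasoro_coeff p p' (r + p * k) (s + p' * k) y = virasoro_coeff p p' r s y"
proof -
  have "theta_quotient_coeff (\<lambda>t. (p * t + (r + p * k)) * (p' * t + (s + p' * k))) y
      = theta_quotient_coeff (\<lambda>t. (p * t + r) * (p' * t + s)) (y - 0)"
    by (rule theta_quotient_coeff_reindex[of "\<lambda>t. t + k"]) (auto simp: algebra_simps intro!: bij_plus_right)
  then show ?thesis by (simp add: virasoro_coeff_def algebra_simps)
qed

lemma virasoro_coeff_reflect:
  "virasoro_coeff p p' (- r) s y = - virasoro_coeff p p' r s (y + r * s)"
proof -
  have "theta_quotient_coeff (\<lambda>t. t * (p * p' * t + (- r) * p' - p * s)) y
      = theta_quotient_coeff (\<lambda>t. (p * t + r) * (p' * t + s)) (y - - (r * s))"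
    by (rule theta_quotient_coeff_reindex[of uminus]) (auto simp: algebra_simps intro!: bij_uminus)
  moreover have "theta_quotient_coeff (\<lambda>t. (p * t + - r) * (p' * t + s)) y
      = theta_quotient_coeff (\<lambda>t. t * (p * p' * t + r * p' - p * s)) (y - - (r * s))"
    by (rule theta_quotient_coeff_reindex[of uminus]) (auto simp: algebra_simps intro!: bij_uminus)
  ultimately show ?thesis by (simp add: virasoro_coeff_def)
qed

lemma virasoro_coeff_swap: "virasoro_coeff p' p s r y = virasoro_coeff p p' r s y"
proof -
  have "theta_quotient_coeff (\<lambda>t. t * (p' * p * t + s * p - p' * r)) y
      = theta_quotient_coeff (\<lambda>t. t * (p * p' * t + r * p' - p * s)) (y - 0)"
    by (rule theta_quotient_coeff_reindex[of uminus]) (auto simp: algebra_simps intro!: bij_uminus)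
  then show ?thesis by (simp add: virasoro_coeff_def mult.commute)
qed

text \<open>
  Lattice translations move \<open>(r, s)\<close> to \<open>- p \<le> r \<le> p\<close> and \<open>0 \<le> s \<le> p'\<close>, where the sign is that of \<open>r\<close>
  because negative \<open>r\<close> are reflected to positive ones. The argument needs \<open>p' < p\<close>, or \<open>p < p'\<close> after
  exchanging the pairs.
\<close>
theorem virasoro_coeff_constant_sign:
  assumes "0 < p" "0 < p'" "p \<noteq> p'"
  obtains \<sigma> :: real where "\<sigma> \<noteq> 0" "\<And>y. \<sigma> * virasoro_coeff p p' r s y \<ge> 0"
proof -
  have less: "\<exists>\<sigma>::real. \<sigma> \<noteq> 0 \<and> (\<forall>y. \<sigma> * virasoro_coeff p p' r s y \<ge> 0)" if p: "0 < p'" "p' < p" for p p' r s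
  proof -
    define k where "k = s div p'"
    define s0 where "s0 = s mod p'"
    define r1 where "r1 = r - p * k"
    define m where "m = (r1 + p) div (2 * p)"
    define r0 where "r0 = (r1 + p) mod (2 * p) - p"
    have s: "s = s0 + p' * k" by (simp add: s0_def k_def)
    have s0: "0 \<le> s0" "s0 \<le> p'" using p by (simp_all add: s0_def less_imp_le)
    have "r1 + p = 2 * p * m + (r0 + p)" unfolding m_def r0_def by simp
    then have r1: "r1 = r0 + 2 * p * m" by simp
    have r0: "- p \<le> r0" "r0 \<le> p"
      using p pos_mod_bound[of "2 * p" "r1 + p"] pos_mod_sign[of "2 * p" "r1 + p"] unfolding r0_def by linarith+
    obtain d where d: "\<And>y. virasoro_coeff p p' r s y = virasoro_coeff p p' r0 s0 (y + d)"
      using virasoro_coeff_shift_both[of p p' r1 k s0] virasoro_coeff_shift_r[of p p' r0 m s0]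
      by (metis r1_def s r1 diff_add_cancel)
    show ?thesis
    proof (cases "r0 \<ge> 0")
      case True
      then have "\<forall>y. 1 * virasoro_coeff p p' r s y \<ge> 0"
        using virasoro_coeff_nonneg_fundamental[OF p _ r0(2) s0] d by simp
      then show ?thesis by (intro exI[of _ 1]) auto
    next
      case False
      have "virasoro_coeff p p' (- r0) s0 y \<ge> 0" for y
        by (rule virasoro_coeff_nonneg_fundamental[OF p _ _ s0]) (use False r0 in auto)
      then have "\<forall>y. (-1) * virasoro_coeff p p' r s y \<ge> 0"
        using virasoro_coeff_reflect[of p p' "- r0" s0] d by simp
      then show ?thesis by (intro exI[of _ "-1"]) auto
    qed
  qed
  consider "p' < p" | "p < p'" using assms by linarith
  then have "\<exists>\<sigma>::real. \<sigma> \<noteq> 0 \<and> (\<forall>y. \<sigma> * virasoro_coeff p p' r s y \<ge> 0)"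
  proof cases
    case 1
    then show ?thesis using less assms by blast
  next
    case 2
    then show ?thesis using less[of p p' s r] assms by (simp add: virasoro_coeff_swap)
  qed
  then show ?thesis using that by blast
qed

section \<open>Residue classes of coefficients\<close>

lemma inverse_qpoch_inf_X_power_nth:
  assumes "n > 0"
  shows "fps_nth (inverse (qpoch_inf [fps_X ^ n] (fps_X ^ n))) i
       = (if n dvd i then partition_coeff (int (i div n)) else 0)"
proof -
  let ?q = "qpoch_inf [fps_X] fps_X :: real fps"
  have "?q oo fps_X ^ n = qpoch_inf [fps_X ^ n] (fps_X ^ n)"
  proof (rule agree_all_imp_eq)
    fix d :: nat
    define f where "f = (\<Prod>i<d. \<Prod>u\<leftarrow>[fps_X]. 1 - u * fps_X ^ i :: real fps)"
    have "agree d ?q f" unfolding f_def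
      by (rule agree_qpoch_inf) auto
    then have "agree d (?q oo fps_X ^ n) (f oo fps_X ^ n)"
      by (auto simp: agree_def fps_nth_compose_X_power intro: le_less_trans[OF div_le_dividend])
    also have "f oo fps_X ^ n = (\<Prod>i<d. \<Prod>u\<leftarrow>[fps_X ^ n]. 1 - u * (fps_X ^ n) ^ i)"
      using assms by (simp add: f_def fps_compose_prod_distrib fps_compose_sub_distrib fps_compose_mult_distrib
          flip: fps_compose_power)
    also have "agree d \<dots> (qpoch_inf [fps_X ^ n] (fps_X ^ n))"
      by (rule agree_sym, rule agree_qpoch_inf) (use assms in auto)
    finally show "agree d (?q oo fps_X ^ n) (qpoch_inf [fps_X ^ n] (fps_X ^ n))" .
  qed
  moreover have "fps_nth ?q 0 = 1" by (rule qpoch_inf_nth_0) auto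
  ultimately have "inverse (qpoch_inf [fps_X ^ n] (fps_X ^ n)) = inverse ?q oo fps_X ^ n"
    using assms by (subst fps_inverse_compose) auto
  then show ?thesis
    by (simp add: fps_nth_compose_X_power partition_coeff_def)
qed

lemma qseries_mult_nth:
  assumes "\<And>t. E t \<ge> 0" "\<And>n. finite {t. E t = int n}"
  shows "fps_nth (qseries UNIV (\<lambda>_. 1) E * f) j = (\<Sum>t | E t \<le> int j. fps_nth f (j - nat (E t)))"
proof -
  have eq: "{t. E t \<le> int j} = (\<Union>i\<in>{0..j}. {t. E t = int i})"
  proof (intro equalityI subsetI)
    fix t assume "t \<in> {t. E t \<le> int j}"
    with assms(1)[of t] have "nat (E t) \<in> {0..j}" "E t = int (nat (E t))" by auto
    then show "t \<in> (\<Union>i\<in>{0..j}. {t. E t = int i})" by blast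
  qed auto
  have "fps_nth (qseries UNIV (\<lambda>_. 1) E * f) j = (\<Sum>i=0..j. \<Sum>t | E t = int i. fps_nth f (j - nat (E t)))"
    by (simp add: fps_mult_nth qseries_nth)
  also have "\<dots> = (\<Sum>t\<in>(\<Union>i\<in>{0..j}. {t. E t = int i}). fps_nth f (j - nat (E t)))"
    by (rule sum.UNION_disjoint[symmetric]) (use assms(2) in auto)
  finally show ?thesis unfolding eq .
qed

text \<open>
  If \<open>E\<close> is injective modulo \<open>n\<close>, the exponents congruent to \<open>j\<close> come from the single class
  \<open>k + n x\<close>. As the denominator is a series in \<open>q^n\<close>, the coefficient at \<open>j\<close> is a coefficient of a theta quotient in
  \<open>q^n\<close> with exponents \<open>F\<close>.
\<close>
lemma coeff_residue_class:
  assumes "n > 0" "\<And>t. E t \<ge> \<bar>t\<bar>"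
    and F: "\<And>x. E (k + int n * x) = E k + int n * F x"
    and inj: "\<And>t. int n dvd E t - E k \<Longrightarrow> int n dvd t - k"
    and j: "int n dvd int j - E k"
  shows "fps_nth (qseries UNIV (\<lambda>_. 1) E * inverse (qpoch_inf [fps_X ^ n] (fps_X ^ n))) j
       = theta_quotient_coeff F ((int j - E k) div int n)"
proof -
  have E0: "E t \<ge> 0" for t using assms(2)[of t] by linarith
  obtain y where y: "int j - E k = int n * y" using j by auto
  have fin: "finite {t. E t \<le> int j}"
    by (rule finite_subset[of _ "{-int j..int j}"]) (use assms(2) order_trans in \<open>fastforce simp: abs_le_iff\<close>)+
  have "fps_nth (qseries UNIV (\<lambda>_. 1) E * inverse (qpoch_inf [fps_X ^ n] (fps_X ^ n))) j
     = (\<Sum>t | E t \<le> int j. if n dvd j - nat (E t) then partition_coeff (int ((j - nat (E t)) div n)) else 0)"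
    using finite_ge_abs[OF assms(2), of UNIV] E0
    by (subst qseries_mult_nth) (auto simp: inverse_qpoch_inf_X_power_nth[OF assms(1)])
  also have "\<dots> = (\<Sum>t | E t \<le> int j. if int n dvd int j - E t then partition_coeff ((int j - E t) div int n) else 0)"
  proof (intro sum.cong refl)
    fix t assume "t \<in> {t. E t \<le> int j}"
    then have "int (j - nat (E t)) = int j - E t" using E0[of t] by simp
    then show "(if n dvd j - nat (E t) then partition_coeff (int ((j - nat (E t)) div n)) else 0)
      = (if int n dvd int j - E t then partition_coeff ((int j - E t) div int n) else 0)"
      by (metis of_nat_div int_dvd_int_iff)
  qed
  also have "\<dots> = (\<Sum>t | E t \<le> int j \<and> int n dvd int j - E t. partition_coeff ((int j - E t) div int n))"
    using fin by (simp add: sum.If_cases Int_def conj_commute)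
  also have "\<dots> = (\<Sum>x | F x \<le> y. partition_coeff (y - F x))"
  proof (rule sum.reindex_bij_witness[of _ "\<lambda>x. k + int n * x" "\<lambda>t. (t - k) div int n"])
    fix t assume t: "t \<in> {t. E t \<le> int j \<and> int n dvd int j - E t}"
    then have "int n dvd int j - E t" by simp
    with j have "int n dvd (int j - E k) - (int j - E t)" by (rule dvd_diff)
    then have "int n dvd t - k" using inj by simp
    then obtain x where x: "t = k + int n * x" by (auto simp: dvd_def algebra_simps)
    have eq: "int j - E t = int n * (y - F x)" using y F[of x] by (simp add: x algebra_simps)
    show "k + int n * ((t - k) div int n) = t" using x assms(1) by simp
    show "(t - k) div int n \<in> {x. F x \<le> y}"
      using t eq assms(1) by (simp add: x) (smt (verit) mult_nonneg_nonneg zero_le_mult_iff of_nat_0_less_iff)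
    show "partition_coeff (y - F ((t - k) div int n)) = partition_coeff ((int j - E t) div int n)"
      unfolding eq using assms(1) by (simp add: x)
  next
    fix x assume x: "x \<in> {x. F x \<le> y}"
    have eq: "int j - E (k + int n * x) = int n * (y - F x)" using y F[of x] by (simp add: algebra_simps)
    show "(k + int n * x - k) div int n = x" using assms(1) by simp
    have "int n * (y - F x) \<ge> 0" using x by simp
    then show "k + int n * x \<in> {t. E t \<le> int j \<and> int n dvd int j - E t}" using eq by (metis (no_types, lifting) dvd_triv_left mem_Collect_eq diff_ge_0_iff_ge)
  qed
  also have "\<dots> = theta_quotient_coeff F ((int j - E k) div int n)"
    using assms(1) by (simp add: theta_quotient_coeff_def y)
  finally show ?thesis .
qed

lemma injective_mod_imp_surjective_mod:
  assumes "n > 0" "\<And>s t. int n dvd E s - E t \<Longrightarrow> int n dvd s - t"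
  obtains k :: int where "int n dvd j - (E k :: int)"
proof -
  have "inj_on (\<lambda>x. E x mod int n) {0..<int n}"
  proof (rule inj_onI)
    fix x y assume xy: "x \<in> {0..<int n}" "y \<in> {0..<int n}" "E x mod int n = E y mod int n"
    then have "int n dvd x - y" using assms(2) by (simp add: mod_eq_dvd_iff)
    then have "x mod int n = y mod int n" by (simp add: mod_eq_dvd_iff)
    then show "x = y" using xy by simp
  qed
  moreover have "(\<lambda>x. E x mod int n) ` {0..<int n} \<subseteq> {0..<int n}" using assms(1) by auto
  ultimately have "(\<lambda>x. E x mod int n) ` {0..<int n} = {0..<int n}" by (intro endo_inj_surj) auto
  moreover have "j mod int n \<in> {0..<int n}" using assms(1) by simp
  ultimately have "j mod int n \<in> (\<lambda>x. E x mod int n) ` {0..<int n}" by (simp only:)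
  then obtain k where "j mod int n = E k mod int n" by blast
  then show ?thesis using that by (simp add: mod_eq_dvd_iff)
qed

lemma coprime_int_primeI:
  assumes "n > 0" "\<And>q. prime q \<Longrightarrow> q dvd n \<Longrightarrow> \<not> int q dvd z"
  shows "coprime (int n) z"
proof (rule ccontr)
  assume "\<not> coprime (int n) z"
  then have "gcd (int n) z \<noteq> 1" by (simp add: coprime_iff_gcd_eq_1)
  then obtain q :: int where q: "prime q" "q dvd gcd (int n) z"
    using assms(1) prime_divisor_exists[of "gcd (int n) z"] by auto
  have nq: "prime (nat q)" using q(1) prime_int_nat_transfer by blast
  have iq: "int (nat q) = q" using prime_ge_0_int[OF q(1)] by (rule int_nat_eq[THEN trans, OF if_P])
  have "q dvd int n" "q dvd z" using q(2) gcd_dvd1 gcd_dvd2 dvd_trans by blast+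
  then have "int (nat q) dvd int n" "int (nat q) dvd z" unfolding iq by blast+
  then show False using assms(2)[OF nq] int_dvd_int_iff by blast
qed

text \<open>
  The class of \<open>j\<close> modulo \<open>n\<close> determines \<open>p\<close>, \<open>p'\<close>, \<open>r\<close>, \<open>s\<close> and hence the sign \<open>\<sigma>\<close> that serves both
  \<open>\<psi>\<^sub>j\<close> and \<open>\<psi>\<^sub>j\<^sub>+\<^sub>n\<close>.
\<close>
theorem theorem3p12:
  fixes a B c n :: nat
  assumes "a > 0" and "B > 0" and "c > 0" and "n > 0"
    and "a > c"
    and "\<not> 3 dvd a"
    and "coprime a c"
    and "coprime B n"
    and "\<forall>p. prime p \<and> p dvd n \<and> p \<noteq> 3 \<longrightarrow> p dvd a"
  shows "\<forall>j. fps_nth (psi a B c n) j * fps_nth (psi a B c n) (j + n) \<ge> 0"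
proof
  fix j
  note n = \<open>n > 0\<close> and pos = \<open>B > 0\<close> \<open>c > 0\<close> \<open>a > c\<close>
  let ?D = "qpoch_inf [fps_X ^ n] (fps_X ^ n) :: real fps"
  let ?E1 = "quint_plus a B c" and ?E2 = "quint_minus a B c"
  have not_prime_c: "\<not> q dvd c" if "prime q" "q dvd a" for q
    using \<open>coprime a c\<close> that by (meson coprime_common_divisor not_prime_unit)
  \<comment> \<open>Both \<open>E1\<close> (with \<open>e = -1\<close>) and \<open>E2\<close> (with \<open>e = 1\<close>) are injective modulo \<open>n\<close> because of this factor of their differences.\<close>
  have cop: "coprime (int n) (3 * int a * x + e * int a + 3 * int c)" if e: "e = 1 \<or> e = -1" for e x :: int
  proof (rule coprime_int_primeI[OF n], rule notI)
    fix q assume q: "prime q" "q dvd n" "int q dvd 3 * int a * x + e * int a + 3 * int c"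
    show False
    proof (cases "q = 3")
      case True
      have "int q dvd (3 * int a * x + e * int a + 3 * int c) - 3 * (int a * x + int c)"
        by (rule dvd_diff[OF q(3)]) (simp add: True)
      then have "int 3 dvd int a" using e True by (auto simp: algebra_simps)
      then show False using \<open>\<not> 3 dvd a\<close> int_dvd_int_iff by blast
    next
      case False
      then have qa: "q dvd a" using assms(9) q by blast
      then have "int q dvd (3 * int a * x + e * int a + 3 * int c) - int a * (3 * x + e)"
        by (intro dvd_diff[OF q(3)]) simp
      then have "int q dvd int (3 * c)" by (simp add: algebra_simps)
      then have "q dvd 3 * c" using int_dvd_int_iff by blast
      then have "q dvd 3 \<or> q dvd c" using q(1) by (simp add: prime_dvd_mult_iff)
      then show False using not_prime_c[OF q(1) qa] False q(1) primes_dvd_imp_eq[of q 3] by auto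
    qed
  qed
  have copB: "coprime (int n) (int B)" using \<open>coprime B n\<close> by (simp add: coprime_commute)
  have inj1: "int n dvd s - t" if "int n dvd ?E1 s - ?E1 t" for s t
  proof -
    have "?E1 s - ?E1 t = int B * ((3 * int a * (s + t) + (-1) * int a + 3 * int c) * (s - t))"
      by (simp add: quint_plus_def algebra_simps)
    with that show ?thesis using copB cop[OF disjI2[OF refl], of "s + t"] by (simp only: coprime_dvd_mult_right_iff)
  qed
  have inj2: "int n dvd s - t" if "int n dvd ?E2 s - ?E2 t" for s t
  proof -
    have "?E2 s - ?E2 t = int B * ((3 * int a * (s + t) + 1 * int a + 3 * int c) * (s - t))"
      by (simp add: quint_minus_def algebra_simps)
    with that show ?thesis using copB cop[OF disjI1[OF refl], of "s + t"] by (simp only: coprime_dvd_mult_right_iff)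
  qed
  obtain k where k: "int n dvd int j - ?E1 k" using injective_mod_imp_surjective_mod[OF n inj1] by blast
  obtain l where l: "int n dvd int j - ?E2 l" using injective_mod_imp_surjective_mod[OF n inj2] by blast
  obtain m where nm: "n = 3 ^ multiplicity 3 n * m" and "\<not> 3 dvd m"
    using multiplicity_decompose'[of n 3] n by auto
  define u where "u = (3::nat) ^ multiplicity 3 n"
  have num: "n = u * m" using nm by (simp add: u_def)
  have m: "m > 0" using n num by (cases "m = 0") auto
  have u: "u > 0" by (simp add: u_def)
  define w where "w = 3 * (l - k) + 1"
  define v where "v = int a * (k + l) + int c"
  have diff: "?E2 l - ?E1 k = int B * (w * v)"
    by (simp add: quint_minus_def quint_plus_def w_def v_def algebra_simps)
  have "int n dvd (int j - ?E1 k) - (int j - ?E2 l)" using k l by (rule dvd_diff)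
  then have "int n dvd ?E2 l - ?E1 k" by simp
  then have wv: "int n dvd w * v" unfolding diff using copB by (simp only: coprime_dvd_mult_right_iff)
  \<comment> \<open>The part of \<open>n\<close> prime to \<open>3\<close> must divide \<open>w\<close>, and the power of \<open>3\<close> must divide \<open>v\<close>.\<close>
  have "coprime (int m) v"
  proof (rule coprime_int_primeI[OF m], rule notI)
    fix q assume q: "prime q" "q dvd m" "int q dvd v"
    then have "q \<noteq> 3" "q dvd n" using \<open>\<not> 3 dvd m\<close> by (auto simp: num)
    then have qa: "q dvd a" using assms(9) q by blast
    then have "int q dvd v - int a * (k + l)" by (intro dvd_diff[OF q(3)]) simp
    then have "q dvd c" by (simp add: v_def)
    then show False using not_prime_c[OF q(1) qa] by simp
  qed
  moreover have "int m dvd w * v" using wv num by (simp add: dvd_mult_right)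
  ultimately have "int m dvd w" by (simp add: coprime_dvd_mult_left_iff)
  then obtain w' where w': "w = int m * w'" by auto
  have "coprime 3 w"
    unfolding w_def by (metis add.commute coprime_1_right coprime_iff_gcd_eq_1 gcd_add_mult mult.commute)
  then have "coprime (int u) w" by (simp add: u_def)
  moreover have "int u dvd w * v" using wv num by (simp add: dvd_mult_left)
  ultimately have "int u dvd v" by (simp add: coprime_dvd_mult_right_iff)
  then obtain v' where v': "v = int u * v'" by auto
  define p where "p = 3 * int u * int B"
  define p' where "p' = int a * int m"
  define r where "r = int B * w'"
  have ppos: "p > 0" "p' > 0" using pos u m by (simp_all add: p_def p'_def)
  have "p \<noteq> p'"
  proof
    assume "p = p'"
    then have "int (a * m) = int (3 * (u * B))" by (simp add: p_def p'_def)
    then have "a * m = 3 * (u * B)" using of_nat_eq_iff by blast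
    then have "3 dvd a * m" by simp
    then show False using \<open>\<not> 3 dvd a\<close> \<open>\<not> 3 dvd m\<close> by (simp add: prime_dvd_mult_iff)
  qed
  have psi: "psi a B c n = qseries UNIV (\<lambda>_. 1) ?E1 * inverse ?D - qseries UNIV (\<lambda>_. 1) ?E2 * inverse ?D"
  proof -
    have "fps_nth ?D 0 = 1" by (rule qpoch_inf_nth_0) (use n in auto)
    then show ?thesis unfolding psi_def quintuple_product[OF pos]
      by (subst fps_divide_unit) (auto simp: left_diff_distrib)
  qed
  \<comment> \<open>The exponents along the classes of \<open>k\<close> and \<open>l\<close>, reduced by their value at \<open>x = 0\<close> and divided by \<open>n\<close>.\<close>
  define F1 where "F1 x = int B * (x * (3 * int a * int n * x + (3 * v - int a * w)))" for x
  define F2 where "F2 x = int B * (x * (3 * int a * int n * x + (3 * v + int a * w)))" for x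
  have F1: "?E1 (k + int n * x) = ?E1 k + int n * F1 x" for x
    by (simp add: quint_plus_def F1_def v_def w_def algebra_simps)
  have F2: "?E2 (l + int n * x) = ?E2 l + int n * F2 x" for x
    by (simp add: quint_minus_def F2_def v_def w_def algebra_simps)
  have main: "fps_nth (psi a B c n) i = virasoro_coeff p p' r v' ((int i - ?E1 k) div int n)"
    if i: "int n dvd int i - int j" for i
  proof -
    have ik: "int n dvd int i - ?E1 k" and il: "int n dvd int i - ?E2 l"
      using dvd_add[OF i k] dvd_add[OF i l] by simp_all
    define y where "y = (int i - ?E1 k) div int n"
    have y: "int i - ?E1 k = int n * y" using ik by (simp add: y_def)
    have "int i - ?E2 l = int n * (y - r * v')"
      using y diff by (simp add: w' v' r_def num algebra_simps)
    then have y2: "(int i - ?E2 l) div int n = y - r * v'" using n by simp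
    have "fps_nth (psi a B c n) i = theta_quotient_coeff F1 y - theta_quotient_coeff F2 (y - r * v')"
      unfolding psi fps_sub_nth
      using coeff_residue_class[OF n quint_plus_ge[OF pos] F1 inj1 ik]
        coeff_residue_class[OF n quint_minus_ge[OF pos] F2 inj2 il]
      by (simp only: y2 y_def)
    also have "theta_quotient_coeff F1 y = theta_quotient_coeff (\<lambda>t. t * (p * p' * t + r * p' - p * v')) (y - 0)"
      by (rule theta_quotient_coeff_reindex[of uminus])
         (auto simp: F1_def w' v' p_def p'_def r_def num algebra_simps intro!: bij_uminus)
    also have "theta_quotient_coeff F2 (y - r * v') = theta_quotient_coeff (\<lambda>t. (p * t + r) * (p' * t + v')) (y - r * v' - - (r * v'))"
      by (rule theta_quotient_coeff_reindex[of id])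
         (auto simp: F2_def w' v' p_def p'_def r_def num algebra_simps)
    finally show ?thesis by (simp add: virasoro_coeff_def y_def)
  qed
  obtain \<sigma> :: real where \<sigma>: "\<sigma> \<noteq> 0" "\<And>y. \<sigma> * virasoro_coeff p p' r v' y \<ge> 0"
    using virasoro_coeff_constant_sign[OF ppos \<open>p \<noteq> p'\<close>] by blast
  have "\<sigma> * fps_nth (psi a B c n) j \<ge> 0" "\<sigma> * fps_nth (psi a B c n) (j + n) \<ge> 0"
    using main[of j] main[of "j + n"] \<sigma>(2) by simp_all
  then have "0 \<le> (\<sigma> * fps_nth (psi a B c n) j) * (\<sigma> * fps_nth (psi a B c n) (j + n))" by simp
  also have "\<dots> = \<sigma>\<^sup>2 * (fps_nth (psi a B c n) j * fps_nth (psi a B c n) (j + n))"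
    by (simp add: power2_eq_square)
  finally show "0 \<le> fps_nth (psi a B c n) j * fps_nth (psi a B c n) (j + n)"
    using \<sigma>(1) by (simp add: zero_le_mult_iff)
qed

end
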